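(* Let $K\in\{\mathbb{R},\mathbb{C}\}$ and let $w\in\mathrm{GL}_n(\mathbb{C})\ast\mathbf{F}_r$ be a (reduced) word of length $l\ge2$ none of whose critical constants is Tomanov-small with respect to $\mathrm{SL}_n$, i.e. $\mathbf{\Lambda}(\mathbb{C})\cap I(w)=\varnothing$. Then $$\dim\bigl(w(\mathrm{SL}_n(\mathbb{R})^r)\bigr)=\dim\bigl(w(\mathrm{SL}_n(\mathbb{C})^r)\bigr)\ \ge\ d(\mathrm{SL}_n)=2(n-1),$$ where $d(\mathrm{SL}_n)$ denotes the minimum of $\dim\bigl(u(\mathrm{SL}_n(K)^s)\bigr)$ over all words $u\in(\mathrm{SL}_n(\mathbb{C})\ast\mathbf{F}_s)\setminus\mathrm{SL}_n(\mathbb{C})$.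
   Context: Words: $\mathbf{F}_r=\langle x_1,\dots,x_r\rangle$ is the free group of rank $r$. A word with constants in a group $C$ is $w=c_0x_{i(1)}^{\varepsilon(1)}c_1\cdots c_{l-1}x_{i(l)}^{\varepsilon(l)}c_l\in C\ast\mathbf{F}_r$ with $c_j\in C$, $\varepsilon(j)\in\{\pm1\}$, taken reduced: if $i(j)=i(j+1)$ and $\varepsilon(j)=-\varepsilon(j+1)$ then $c_j\ne 1$. Its length is $l$. An index $j\in\{1,\dots,l-1\}$ is critical if $i(j)=i(j+1)$ and $\varepsilon(j)=-\varepsilon(j+1)$; then $c_j$ is a critical constant, and $I(w)$ denotes the set of critical constants. For a subgroup $G\le C$, $w(G^r)\subseteq C$ is the image of the word map $(g_1,\dots,g_r)\mapsto w(g_1,\dots,g_r)$. Dimension: for a subset $T\subseteq\mathbf{M}_n(\mathbb{C})$ (the $n\times n$ complex matrices), $\dim(T)$ is the Krull dimension of its Zariski closure in $\mathbf{M}_n(\mathbb{C})$. Tomanov-small constants: let $e_1,\dots,e_n$ be a basis of $\mathbb{C}^n$ consisting of weight vectors for a maximal torus of $\mathrm{SL}_n$, with $e_1$ a highest and $e_n$ a lowest weight vector, and $e_1^\ast,\dots,e_n^\ast$ the dual basis. Groups act from the right, and $c^g=g^{-1}cg$. Then $\mathbf{\Lambda}(\mathbb{C})=\{c\in\mathrm{GL}_n(\mathbb{C}) : (e_1.c^g).e_n^\ast=0\text{ for all }g\in\mathrm{SL}_n(\mathbb{C})\}$, where $v.e_n^\ast$ is the value of the functional $e_n^\ast$ at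 $v$.
   Formalization: For n ≥ 2 the minimum d(SL_n) is taken only over words u whose image u(SL_n(K)^s) is not a single point; over all words it would be 0, since u = x c x^{-1} with c ≠ 1 central is reduced, of length 2, not in SL_n(C), and has image {c}. *)

theory Defs
  imports "HOL-Analysis.Analysis" "HOL-Library.Extended_Nat"
begin

subsection \<open>Words with constants\<close>

text \<open>
  A word with constants is represented by its leading
  constant \<open>c 0\<close> and the list, for \<open>j = 1, \<dots>, l\<close>, of the triples
  \<open>(i j, \<epsilon> j, c j)\<close>: the variable, its exponent, the constant after it. Variables are numbered from 0, and the exponent is \<open>1\<close> for
  \<^const>\<open>True\<close> and \<open>-1\<close> for \<^const>\<open>False\<close>.
\<close>

datatype 'c cword = CWord (lead_const: 'c) (letters: "(nat \<times> bool \<times> 'c) list")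

definition word_length :: "'c cword \<Rightarrow> nat" where
  "word_length w = length (letters w)"

definition critical_constants :: "'c cword \<Rightarrow> 'c set" where
  "critical_constants w =
     {c. \<exists>j i \<epsilon> c'. Suc j < length (letters w) \<and>
            letters w ! j = (i, \<epsilon>, c) \<and> letters w ! Suc j = (i, \<not> \<epsilon>, c')}"

text \<open>
  Every element of the free product of a matrix group \<open>C\<close> with the free group of rank \<open>r\<close> is
  given by exactly one reduced word, so the free product is represented by its reduced words.
\<close>

definition free_product_words ::
    "('a::field ^ 'n ^ 'n) set \<Rightarrow> nat \<Rightarrow> ('a ^ 'n ^ 'n) cword set" where
  "free_product_words C r =
     {w. lead_const w \<in> C \<and> (\<forall>(i, \<epsilon>, c) \<in> set (letters w). i < r \<and> c \<in> C) \<and>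
         mat 1 \<notin> critical_constants w}"

definition word_eval ::
    "('a::field ^ 'n ^ 'n) cword \<Rightarrow> (nat \<Rightarrow> 'a ^ 'n ^ 'n) \<Rightarrow> 'a ^ 'n ^ 'n" where
  "word_eval w g =
     foldl (\<lambda>A (i, \<epsilon>, c). A ** (if \<epsilon> then g i else matrix_inv (g i)) ** c)
       (lead_const w) (letters w)"

definition word_image ::
    "('a::field ^ 'n ^ 'n) cword \<Rightarrow> ('a ^ 'n ^ 'n) set \<Rightarrow> nat \<Rightarrow> ('a ^ 'n ^ 'n) set" where
  "word_image w G r = word_eval w ` {g. \<forall>i<r. g i \<in> G}"


subsection \<open>Linear groups\<close>

definition GL :: "(complex ^ 'n ^ 'n) set" where
  "GL = {A. invertible A}"

text \<open>\<open>SL K\<close> is the group of \<open>K\<close>-points of the special linear group, for a subfield \<open>K\<close> of the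
  complex numbers.\<close>

definition SL :: "complex set \<Rightarrow> (complex ^ 'n ^ 'n) set" where
  "SL K = {A. det A = 1 \<and> (\<forall>i j. A $ i $ j \<in> K)}"


subsection \<open>Tomanov-small constants\<close>

text \<open>
  Any ordered basis \<open>e\<^sub>1, \<dots>, e\<^sub>n\<close> consists of weight vectors for the maximal torus of all elements
  of the special linear group that are diagonal with respect to it. For the Borel subgroup
  stabilising the flag spanned by initial segments of the basis, \<open>e\<^sub>1\<close> is a highest and \<open>e\<^sub>n\<close> a
  lowest weight vector. Hence the admissible bases are exactly the ordered bases.
  Vectors are rows, since groups act from the right.
\<close>

definition ordered_basis :: "(nat \<Rightarrow> complex ^ 'n) \<Rightarrow> bool" where
  "ordered_basis e \<longleftrightarrow>
     inj_on e {1..CARD('n)} \<and> vec.independent (e ` {1..CARD('n)}) \<and>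
     vec.span (e ` {1..CARD('n)}) = UNIV"

definition dual_basis :: "(nat \<Rightarrow> complex ^ 'n) \<Rightarrow> nat \<Rightarrow> complex ^ 'n \<Rightarrow> complex" where
  "dual_basis e i v = vec.representation (e ` {1..CARD('n)}) v (e i)"

definition tomanov_small :: "(nat \<Rightarrow> complex ^ 'n) \<Rightarrow> (complex ^ 'n ^ 'n) set" where
  "tomanov_small e =
     {c \<in> GL. \<forall>g \<in> SL UNIV.
        dual_basis e CARD('n) (e 1 v* (matrix_inv g ** c ** g)) = 0}"


subsection \<open>Dimension\<close>

inductive_set poly_functions :: "(complex ^ 'n ^ 'n \<Rightarrow> complex) set" where
  const: "(\<lambda>A. a) \<in> poly_functions"
| entry: "(\<lambda>A. A $ i $ j) \<in> poly_functions"
| add: "p \<in> poly_functions \<Longrightarrow> q \<in> poly_functions \<Longrightarrow> (\<lambda>A. p A + q A) \<in> poly_functions"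
| mult: "p \<in> poly_functions \<Longrightarrow> q \<in> poly_functions \<Longrightarrow> (\<lambda>A. p A * q A) \<in> poly_functions"

definition zariski_topology :: "(complex ^ 'n ^ 'n) topology" where
  "zariski_topology = topology_generated_by {{A. p A \<noteq> 0} | p. p \<in> poly_functions}"

definition irreducible_closedin :: "'a topology \<Rightarrow> 'a set \<Rightarrow> bool" where
  "irreducible_closedin X Z \<longleftrightarrow>
     closedin X Z \<and> Z \<noteq> {} \<and>
     (\<forall>A B. closedin X A \<longrightarrow> closedin X B \<longrightarrow> Z = A \<union> B \<longrightarrow> Z = A \<or> Z = B)"

text \<open>The empty space gets dimension 0, but word images are never empty.\<close>

definition krull_dim :: "'a topology \<Rightarrow> enat" where
  "krull_dim X =
     Sup {enat k | k. \<exists>Z :: nat \<Rightarrow> 'a set.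
            (\<forall>i\<le>k. irreducible_closedin X (Z i)) \<and> (\<forall>i<k. Z i \<subset> Z (Suc i))}"

definition zariski_dim :: "(complex ^ 'n ^ 'n) set \<Rightarrow> enat" where
  "zariski_dim T = krull_dim (subtopology zariski_topology (zariski_topology closure_of T))"

text \<open>
  The minimal dimension of the image of a nonconstant word with constants in the complex special
  linear group. Words such as \<open>x c x\<^sup>-\<^sup>1\<close> with \<open>c \<noteq> 1\<close> central are reduced and of positive length
  but have a one-point image, so for \<open>n \<ge> 2\<close> words with constant word map have to be left out
  (otherwise the minimum would be 0). For \<open>n = 1\<close> the group is trivial, and no word is left out.
  The infimum of a nonempty set of type \<^typ>\<open>enat\<close> is a minimum.
\<close>

definition sl_min_dim :: "'n::finite itself \<Rightarrow> complex set \<Rightarrow> enat" where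
  "sl_min_dim _ K =
     Inf {zariski_dim (word_image u (SL K) s) | (u :: (complex ^ 'n ^ 'n) cword) s.
            u \<in> free_product_words (SL UNIV) s \<and> word_length u \<ge> 1 \<and>
            (CARD('n) \<ge> 2 \<longrightarrow> \<not> is_singleton (word_image u (SL K) s))}"

end

theory Submission imports Defs begin

text \<open>
  For \<open>n \<ge> 2\<close> scalars are Tomanov-small, so the critical constants of the word are nonscalar,
  and for nonscalar \<open>c\<close> the form \<open>f c v\<close> does not vanish identically on \<open>f v = 0\<close>. Substitute
  for every variable a product of two conjugates of the transvection \<open>1 + t v f\<close>. The conjugators
  can be chosen such that all the constants between consecutive transvections are nonscalar, so the
  leading coefficient in \<open>t\<close> of the word is \<open>\<kappa> P v f Q\<close> with \<open>P, Q\<close> invertible and \<open>\<kappa>\<close> a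
  nonzero polynomial in \<open>v, f\<close>. The nilpotent matrices of rank one form a cone of dimension
  \<open>2 (n - 1)\<close>, so the image has at least that dimension. Conjugates of a transvection attain the
  bound, and scalar critical constants can be removed from a word without changing its word map.

  Krull dimension is compared with algebraic independence: a chain of irreducible closed sets yields
  independent functions, and conversely a polynomial parametrisation yields a chain.
\<close>

subsection \<open>Algebras of polynomial functions\<close>

text \<open>One transvection per variable would not do: in \<open>x x\<close> the scalar between the
  two rank one terms is f v = 0. Constants at noncritical places are unrestricted, possibly scalar,
  so nonscalar ones have to be manufactured there. With two conjugates per letter, the letter with
  index i and exponent \<epsilon> starts with a conjugator attached to (i, \<not> \<epsilon>) and
  ends with one attached to (i, \<epsilon>). Neighbouring conjugators then agree exactly at the
  critical places, where they merely conjugate the given nonscalar constant; elsewhere they differ,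
  and a generic choice makes the product nonscalar.

  The parameter t is lost when passing to the leading coefficient, which leaves one parameter fewer
  than the cone has dimensions. It comes back through homogeneity: the top-degree part of a supposed
  relation is homogeneous, so its vanishing on the normalised coefficients extends to the whole
  cone. The factor \<kappa> is harmless for the same reason.\<close>

inductive_set alg_gen :: "('a \<Rightarrow> complex) set \<Rightarrow> ('a \<Rightarrow> complex) set" for B where
  const: "(\<lambda>x. a) \<in> alg_gen B"
| gen: "b \<in> B \<Longrightarrow> b \<in> alg_gen B"
| add: "p \<in> alg_gen B \<Longrightarrow> q \<in> alg_gen B \<Longrightarrow> (\<lambda>x. p x + q x) \<in> alg_gen B"
| mult: "p \<in> alg_gen B \<Longrightarrow> q \<in> alg_gen B \<Longrightarrow> (\<lambda>x. p x * q x) \<in> alg_gen B"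

definition matrix_entries :: "(complex ^ 'n ^ 'n \<Rightarrow> complex) set" where
  "matrix_entries = {\<lambda>A. A $ i $ j | i j. True}"

lemma entry_in_alg_gen: "(\<lambda>A. A $ i $ j) \<in> alg_gen matrix_entries"
  by (rule alg_gen.gen) (auto simp: matrix_entries_def)

lemma poly_functions_eq_alg_gen:
  "poly_functions = alg_gen (matrix_entries :: (complex ^ 'n ^ 'n \<Rightarrow> complex) set)" (is "_ = ?R")
proof
  show "poly_functions \<subseteq> ?R"
  proof
    fix p :: "complex ^ 'n ^ 'n \<Rightarrow> complex" assume "p \<in> poly_functions"
    then show "p \<in> ?R"
      by induction (blast intro: alg_gen.intros entry_in_alg_gen)+
  qed
  show "?R \<subseteq> poly_functions"
  proof
    fix p assume "p \<in> ?R"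
    then show "p \<in> poly_functions"
      by induction (auto intro: poly_functions.intros simp: matrix_entries_def)
  qed
qed

lemma alg_gen_sum:
  assumes "\<And>i. i \<in> I \<Longrightarrow> p i \<in> alg_gen B"
  shows "(\<lambda>x. \<Sum>i\<in>I. p i x) \<in> alg_gen B"
  using assms by (induction I rule: infinite_finite_induct) (auto intro: alg_gen.intros)

lemma alg_gen_prod:
  assumes "\<And>i. i \<in> I \<Longrightarrow> p i \<in> alg_gen B"
  shows "(\<lambda>x. \<Prod>i\<in>I. p i x) \<in> alg_gen B"
  using assms by (induction I rule: infinite_finite_induct) (auto intro: alg_gen.intros)

lemma alg_gen_power: "p \<in> alg_gen B \<Longrightarrow> (\<lambda>x. p x ^ n) \<in> alg_gen B"
  by (induction n) (auto intro: alg_gen.intros)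

lemma alg_gen_uminus: "p \<in> alg_gen B \<Longrightarrow> (\<lambda>x. - p x) \<in> alg_gen B"
  using alg_gen.mult[OF alg_gen.const[of "-1"]] by simp

lemma alg_gen_mono: "p \<in> alg_gen B \<Longrightarrow> B \<subseteq> C \<Longrightarrow> p \<in> alg_gen C"
  by (induction rule: alg_gen.induct) (auto intro: alg_gen.intros)

lemma alg_gen_compose:
  assumes "p \<in> alg_gen B" and "\<And>b. b \<in> B \<Longrightarrow> (\<lambda>x. b (\<phi> x)) \<in> alg_gen C"
  shows "(\<lambda>x. p (\<phi> x)) \<in> alg_gen C"
  using assms by induction (auto intro: alg_gen.intros)

lemma poly_functions_compose:
  assumes "p \<in> poly_functions" and "\<And>i j. (\<lambda>x. \<phi> x $ i $ j) \<in> alg_gen C"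
  shows "(\<lambda>x. p (\<phi> x)) \<in> alg_gen C"
  using assms(1) unfolding poly_functions_eq_alg_gen
  by (rule alg_gen_compose) (use assms(2) in \<open>auto simp: matrix_entries_def\<close>)

lemma alg_gen_matrix_mult:
  fixes A :: "'a \<Rightarrow> complex ^ 'm ^ 'n" and M :: "'a \<Rightarrow> complex ^ 'k ^ 'm"
  assumes "\<And>i j. (\<lambda>x. A x $ i $ j) \<in> alg_gen B" "\<And>i j. (\<lambda>x. M x $ i $ j) \<in> alg_gen B"
  shows "(\<lambda>x. (A x ** M x) $ i $ j) \<in> alg_gen B"
  unfolding matrix_matrix_mult_def by (auto intro!: alg_gen_sum alg_gen.mult assms)

lemma alg_gen_det:
  assumes "\<And>i j. (\<lambda>x. A x $ i $ j) \<in> alg_gen B"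
  shows "(\<lambda>x. det (A x)) \<in> alg_gen B"
  unfolding det_def by (intro alg_gen_sum alg_gen.mult alg_gen.const alg_gen_prod assms)

text \<open>The restrictions to \<open>T\<close> of the functions in \<open>R\<close> have no zero
  divisors. For the polynomial functions and nonempty \<open>T\<close> this is irreducibility of the
  Zariski closure.\<close>

definition integral_on :: "('a \<Rightarrow> complex) set \<Rightarrow> 'a set \<Rightarrow> bool" where
  "integral_on R T \<longleftrightarrow> (\<forall>p\<in>R. \<forall>q\<in>R. (\<forall>x\<in>T. p x * q x = 0) \<longrightarrow>
     (\<forall>x\<in>T. p x = 0) \<or> (\<forall>x\<in>T. q x = 0))"

lemma integral_onD:
  assumes "integral_on R T" "p \<in> R" "q \<in> R" "\<And>x. x \<in> T \<Longrightarrow> p x * q x = 0"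
  shows "(\<forall>x\<in>T. p x = 0) \<or> (\<forall>x\<in>T. q x = 0)"
  using assms unfolding integral_on_def by blast

lemma alg_gen_along_curve:
  assumes "p \<in> alg_gen B" and "\<And>b. b \<in> B \<Longrightarrow> \<exists>P. \<forall>z::complex. b (\<gamma> z) = poly P z"
  shows "\<exists>P. \<forall>z. p (\<gamma> z) = poly P z"
  using assms
proof induction
  case (const a)
  show ?case by (rule exI[of _ "[:a:]"]) simp
next
  case (add p q)
  then obtain P Q where "\<forall>z. p (\<gamma> z) = poly P z" "\<forall>z. q (\<gamma> z) = poly Q z" by blast
  then show ?case by (intro exI[of _ "P + Q"]) simp
next
  case (mult p q)
  then obtain P Q where "\<forall>z. p (\<gamma> z) = poly P z" "\<forall>z. q (\<gamma> z) = poly Q z" by blast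
  then show ?case by (intro exI[of _ "P * Q"]) simp
qed simp

text \<open>If p is nonzero at x and q at y, then along a polynomial curve from x to y both become
  nonzero polynomials in one variable, whose product cannot vanish.\<close>

lemma integral_on_line_connected:
  assumes "\<And>x y. \<exists>\<gamma>. \<gamma> 0 = x \<and> \<gamma> 1 = y \<and> (\<forall>b\<in>B. \<exists>P. \<forall>z::complex. b (\<gamma> z) = poly P z)"
  shows "integral_on (alg_gen B) UNIV"
  unfolding integral_on_def
proof (intro ballI impI, rule ccontr)
  fix p q assume pq: "p \<in> alg_gen B" "q \<in> alg_gen B" "\<forall>x\<in>UNIV. p x * q x = 0"
    and "\<not> ((\<forall>x\<in>UNIV. p x = 0) \<or> (\<forall>x\<in>UNIV. q x = 0))"
  then obtain x y where xy: "p x \<noteq> 0" "q y \<noteq> 0" by blast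
  obtain \<gamma> where g: "\<gamma> 0 = x" "\<gamma> 1 = y" "\<And>b. b \<in> B \<Longrightarrow> \<exists>P. \<forall>z::complex. b (\<gamma> z) = poly P z"
    using assms[of x y] by blast
  obtain P Q where P: "\<And>z. p (\<gamma> z) = poly P z" and Q: "\<And>z. q (\<gamma> z) = poly Q z"
    using alg_gen_along_curve[OF pq(1), of \<gamma>] alg_gen_along_curve[OF pq(2), of \<gamma>] g(3) by blast
  have "\<And>z. poly (P * Q) z = 0"
    using pq(3) P Q by (metis UNIV_I poly_mult)
  then have "P * Q = 0" using poly_all_0_iff_0 by blast
  then have "P = 0 \<or> Q = 0" by simp
  then show False using xy P[of 0] Q[of 1] g by auto
qed

lemma integral_on_poly_functions:
  "integral_on (poly_functions :: (complex ^ 'n ^ 'n \<Rightarrow> complex) set) UNIV"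
  unfolding poly_functions_eq_alg_gen
proof (rule integral_on_line_connected)
  fix X Y :: "complex ^ 'n ^ 'n"
  let ?\<gamma> = "\<lambda>z. \<chi> i j. X $ i $ j + z * (Y $ i $ j - X $ i $ j)"
  have "\<forall>z. ?\<gamma> z $ i $ j = poly [:X $ i $ j, Y $ i $ j - X $ i $ j:] z" for i j
    by simp
  then have "\<forall>b\<in>matrix_entries. \<exists>P. \<forall>z. b (?\<gamma> z) = poly P z"
    unfolding matrix_entries_def by blast
  moreover have "?\<gamma> 0 = X" "?\<gamma> 1 = Y" by (simp_all add: vec_eq_iff)
  ultimately show "\<exists>\<gamma>. \<gamma> 0 = X \<and> \<gamma> 1 = Y \<and>
      (\<forall>b\<in>matrix_entries. \<exists>P. \<forall>z::complex. b (\<gamma> z) = poly P z)"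
    by (intro exI[of _ ?\<gamma>] conjI)
qed

text \<open>Polynomials in the first \<open>m\<close> coordinates of an infinite sequence, so that
  the number of variables can change without changing the type.\<close>

definition polyn :: "nat \<Rightarrow> ((nat \<Rightarrow> complex) \<Rightarrow> complex) set" where
  "polyn m = alg_gen {\<lambda>s. s j | j. j < m}"

lemma integral_on_polyn: "integral_on (polyn m) UNIV"
  unfolding polyn_def
proof (rule integral_on_line_connected)
  fix x y :: "nat \<Rightarrow> complex"
  let ?\<gamma> = "\<lambda>z j. x j + z * (y j - x j)"
  have "\<forall>z. ?\<gamma> z j = poly [:x j, y j - x j:] z" for j by simp
  then have "\<forall>b\<in>{\<lambda>s. s j | j. j < m}. \<exists>P. \<forall>z. b (?\<gamma> z) = poly P z" by blast
  moreover have "?\<gamma> 0 = x" "?\<gamma> 1 = y" by auto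
  ultimately show "\<exists>\<gamma>. \<gamma> 0 = x \<and> \<gamma> 1 = y \<and>
      (\<forall>b\<in>{\<lambda>s. s j | j. j < m}. \<exists>P. \<forall>z::complex. b (\<gamma> z) = poly P z)"
    by (intro exI[of _ ?\<gamma>] conjI)
qed

subsection \<open>Algebraic independence\<close>

definition exponents :: "nat \<Rightarrow> nat \<Rightarrow> (nat \<Rightarrow> nat) set" where
  "exponents k N = {..<k} \<rightarrow>\<^sub>E {..N}"

lemma finite_exponents [simp]: "finite (exponents k N)"
  unfolding exponents_def by (intro finite_PiE) auto

lemma card_exponents: "card (exponents k N) = Suc N ^ k"
  unfolding exponents_def by (subst card_PiE) auto

lemma exponents_mono: "M \<le> N \<Longrightarrow> exponents k M \<subseteq> exponents k N"
  unfolding exponents_def by (intro PiE_mono) auto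

text \<open>The degree is bounded by \<open>N\<close> in each function separately: relations become
  finite sums, and there are exactly \<open>Suc N ^ k\<close> monomials to count.\<close>

definition alg_indep :: "nat \<Rightarrow> (nat \<Rightarrow> 'a \<Rightarrow> complex) \<Rightarrow> 'a set \<Rightarrow> bool" where
  "alg_indep k f T \<longleftrightarrow> (\<forall>N c. (\<forall>x\<in>T. (\<Sum>e\<in>exponents k N. c e * (\<Prod>j<k. f j x ^ e j)) = 0) \<longrightarrow>
     (\<forall>e\<in>exponents k N. c e = 0))"

lemma alg_indepI:
  assumes "\<And>N c. (\<And>x. x \<in> T \<Longrightarrow> (\<Sum>e\<in>exponents k N. c e * (\<Prod>j<k. f j x ^ e j)) = 0) \<Longrightarrow>
     (\<And>e. e \<in> exponents k N \<Longrightarrow> c e = 0)"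
  shows "alg_indep k f T"
  using assms unfolding alg_indep_def by blast

lemma alg_indepD:
  assumes "alg_indep k f T"
    and "\<And>x. x \<in> T \<Longrightarrow> (\<Sum>e\<in>exponents k N. c e * (\<Prod>j<k. f j x ^ e j)) = 0"
    and "e \<in> exponents k N"
  shows "c e = 0"
  using assms unfolding alg_indep_def by blast

lemma sum_exponents_Suc:
  "(\<Sum>e\<in>exponents (Suc k) N. h e) = (\<Sum>i\<le>N. \<Sum>e\<in>exponents k N. h (e(k := i)))"
proof -
  have "exponents (Suc k) N = (\<lambda>(i, e). e(k := i)) ` ({..N} \<times> exponents k N)"
    unfolding exponents_def lessThan_Suc by (simp add: PiE_insert_eq)
  moreover have "inj_on (\<lambda>(i, e). e(k := i)) ({..N} \<times> exponents k N)"
  proof (rule inj_onI, clarify)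
    fix i e i' e' assume ee: "e \<in> exponents k N" "e' \<in> exponents k N" "e(k := i) = e'(k := i')"
    \<comment> \<open>Members of \<open>exponents k N\<close> take the default value at
      \<open>k\<close>, so overwriting that value loses no information.\<close>
    have "e k = undefined" "e' k = undefined"
      using ee(1,2) by (auto simp: exponents_def intro: PiE_arb)
    moreover have "i = i'" using fun_cong[OF ee(3), of k] by simp
    moreover have "e j = e' j" if "j \<noteq> k" for j using fun_cong[OF ee(3), of j] that by simp
    ultimately show "i = i' \<and> e = e'" by (metis ext)
  qed
  ultimately show ?thesis
    by (simp add: sum.reindex sum.cartesian_product case_prod_unfold)
qed

lemma exponents_SucE:
  assumes "e \<in> exponents (Suc k) N"
  obtains i e' where "i \<le> N" "e' \<in> exponents k N" "e = e'(k := i)"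
  using assms unfolding exponents_def lessThan_Suc by (auto simp: PiE_insert_eq)

text \<open>A relation on \<open>Y\<close> is read as a polynomial in \<open>f k\<close> with
  coefficients \<open>P i\<close>. If the lower coefficients are zero, a power of \<open>f k\<close>
  can be cancelled because \<open>Y\<close> is irreducible and \<open>f k\<close> is not zero on it.
  On \<open>Z\<close>, where \<open>f k\<close> vanishes, only the lowest remaining coefficient
  survives, and independence on \<open>Z\<close> kills it.\<close>

lemma alg_indep_Suc:
  assumes ind: "alg_indep k f Z" and sub: "Z \<subseteq> Y"
    and int: "integral_on (alg_gen B) Y" and f: "\<And>i. i \<le> k \<Longrightarrow> f i \<in> alg_gen B"
    and zero: "\<And>x. x \<in> Z \<Longrightarrow> f k x = 0" and nz: "\<exists>x\<in>Y. f k x \<noteq> 0"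
  shows "alg_indep (Suc k) f Y"
proof (rule alg_indepI)
  fix N c e
  assume rel: "\<And>x. x \<in> Y \<Longrightarrow> (\<Sum>e\<in>exponents (Suc k) N. c e * (\<Prod>j<Suc k. f j x ^ e j)) = 0"
    and e: "e \<in> exponents (Suc k) N"
  define P where "P i x = (\<Sum>e\<in>exponents k N. c (e(k := i)) * (\<Prod>j<k. f j x ^ e j))" for i x
  have Pgen: "P i \<in> alg_gen B" for i
    unfolding P_def
    by (intro alg_gen_sum alg_gen.mult alg_gen.const alg_gen_prod alg_gen_power f) auto
  have relP: "(\<Sum>i\<le>N. P i x * f k x ^ i) = 0" if "x \<in> Y" for x
  proof -
    have "(\<Sum>i\<le>N. P i x * f k x ^ i) =
        (\<Sum>e\<in>exponents (Suc k) N. c e * (\<Prod>j<Suc k. f j x ^ e j))"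
      unfolding sum_exponents_Suc P_def sum_distrib_right
      by (intro sum.cong refl) (auto simp: mult.assoc intro!: prod.cong)
    then show ?thesis using rel[OF that] by simp
  qed
  have coeff: "\<forall>e\<in>exponents k N. c (e(k := i)) = 0" if "i \<le> N" for i
    using that
  proof (induction i rule: less_induct)
    case (less i)
    have low: "P i' x = 0" if "i' < i" for i' x
    proof -
      have "\<forall>e\<in>exponents k N. c (e(k := i')) = 0" using less.IH[OF that] less.prems that by (meson less_le_trans less_imp_le)
      then show ?thesis unfolding P_def by simp
    qed
    \<comment> \<open>The relation divided by the \<open>i\<close>-th power of
      \<open>f k\<close>.\<close>
    define Q where "Q x = (\<Sum>i'\<in>{i..N}. P i' x * f k x ^ (i' - i))" for x
    have "Q \<in> alg_gen B" unfolding Q_def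
      by (intro alg_gen_sum alg_gen.mult Pgen alg_gen_power f) auto
    moreover have "f k x ^ i * Q x = 0" if "x \<in> Y" for x
    proof -
      have "f k x ^ i * Q x = (\<Sum>i'\<in>{i..N}. P i' x * f k x ^ i')"
        unfolding Q_def sum_distrib_left
        by (intro sum.cong refl) (simp add: algebra_simps flip: power_add)
      also have "\<dots> = (\<Sum>i'\<le>N. P i' x * f k x ^ i')"
        by (rule sum.mono_neutral_left) (auto simp: low)
      finally show ?thesis using relP[OF that] by simp
    qed
    moreover have "(\<lambda>x. f k x ^ i) \<in> alg_gen B" by (intro alg_gen_power f) simp
    ultimately have "(\<forall>x\<in>Y. f k x ^ i = 0) \<or> (\<forall>x\<in>Y. Q x = 0)"
      using integral_onD[OF int, of "\<lambda>x. f k x ^ i" Q] by simp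
    then have Q0: "\<forall>x\<in>Y. Q x = 0" using nz by auto
    have "P i x = 0" if "x \<in> Z" for x
    proof -
      have "Q x = (\<Sum>i'\<in>{i..N}. if i' = i then P i' x else 0)"
        unfolding Q_def using zero[OF that] by (intro sum.cong) auto
      then have "Q x = P i x" using less.prems by simp
      then show ?thesis using Q0 that sub by auto
    qed
    then show ?case
      using alg_indepD[OF ind, where N = N and c = "\<lambda>e. c (e(k := i))"] unfolding P_def by blast
  qed
  show "c e = 0" using coeff exponents_SucE[OF e] by metis
qed

text \<open>Every strict step of a chain of irreducible sets contributes one more independent
  function, namely one that vanishes on the smaller set but not on the larger.\<close>

lemma alg_indep_chain:
  assumes "Z 0 \<noteq> {}"
    and "\<And>i. i < k \<Longrightarrow> Z i \<subseteq> Z (Suc i)"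
    and "\<And>i. i < k \<Longrightarrow> integral_on (alg_gen B) (Z (Suc i))"
    and "\<And>i. i < k \<Longrightarrow> f i \<in> alg_gen B"
    and "\<And>i x. i < k \<Longrightarrow> x \<in> Z i \<Longrightarrow> f i x = 0"
    and "\<And>i. i < k \<Longrightarrow> \<exists>x\<in>Z (Suc i). f i x \<noteq> 0"
  shows "alg_indep k f (Z k)"
  using assms
proof (induction k)
  case 0
  then show ?case by (auto intro!: alg_indepI simp: exponents_def)
next
  case (Suc k)
  show ?case
    by (rule alg_indep_Suc[of k f "Z k" _ B]) (use Suc in auto)
qed

section \<open>Dependence of more than m polynomials in m variables, by counting monomials\<close>

lemma exists_nontrivial_solution:
  assumes "finite A" "finite E" "card A < card E"
  shows "\<exists>x :: 'e \<Rightarrow> complex. (\<exists>e\<in>E. x e \<noteq> 0) \<and> (\<forall>a\<in>A. (\<Sum>e\<in>E. x e * M e a) = 0)"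
  using assms
proof (induction A arbitrary: E M rule: finite_induct)
  case empty
  then have "E \<noteq> {}" by auto
  then show ?case by (intro exI[of _ "\<lambda>_. 1"]) auto
next
  case (insert a A)
  show ?case
  proof (cases "\<forall>e\<in>E. M e a = 0")
    case True
    then show ?thesis using insert.IH[of E M] insert.prems insert.hyps by auto
  next
    case False
    then obtain e0 where e0: "e0 \<in> E" "M e0 a \<noteq> 0" by auto
    define E' where "E' = E - {e0}"
    have E': "finite E'" "card A < card E'" "E = insert e0 E'" "e0 \<notin> E'"
      using insert e0 by (auto simp: E'_def)
    obtain x e1 where x: "e1 \<in> E'" "x e1 \<noteq> 0"
      "\<And>b. b \<in> A \<Longrightarrow> (\<Sum>e\<in>E'. x e * (M e b - M e a / M e0 a * M e0 b)) = 0"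
      using insert.IH[OF E'(1,2), of "\<lambda>e b. M e b - M e a / M e0 a * M e0 b"] by blast
    \<comment> \<open>Gaussian elimination: the unknown at \<open>e0\<close> is determined by
      equation \<open>a\<close>, and \<open>x\<close> solves the other equations after this
      substitution.\<close>
    define y where "y = x(e0 := - (\<Sum>e\<in>E'. x e * M e a) / M e0 a)"
    have y: "(\<Sum>e\<in>E. y e * M e b) =
        - (\<Sum>e\<in>E'. x e * M e a) / M e0 a * M e0 b + (\<Sum>e\<in>E'. x e * M e b)" for b
    proof -
      have "(\<Sum>e\<in>E'. y e * M e b) = (\<Sum>e\<in>E'. x e * M e b)"
        using E'(4) by (intro sum.cong) (auto simp: y_def)
      then show ?thesis using E' by (simp add: y_def)
    qed
    have "(\<Sum>e\<in>E. y e * M e b) = 0" if "b \<in> insert a A" for b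
    proof (cases "b = a")
      case True
      then show ?thesis using e0 by (simp add: y)
    next
      case False
      then have "b \<in> A" using that by simp
      have "(\<Sum>e\<in>E. y e * M e b) = (\<Sum>e\<in>E'. x e * (M e b - M e a / M e0 a * M e0 b))"
        unfolding y right_diff_distrib sum_subtractf
        by (simp add: sum_divide_distrib sum_distrib_right mult.assoc)
      then show ?thesis using x(3)[OF \<open>b \<in> A\<close>] by simp
    qed
    moreover have "y e1 \<noteq> 0" using x E'(4) by (auto simp: y_def)
    ultimately show ?thesis using x(1) E'(3) by blast
  qed
qed

definition bounded_poly :: "nat \<Rightarrow> nat \<Rightarrow> ((nat \<Rightarrow> complex) \<Rightarrow> complex) \<Rightarrow> bool" where
  "bounded_poly m D p \<longleftrightarrow> (\<exists>c. \<forall>s. p s = (\<Sum>e\<in>exponents m D. c e * (\<Prod>j<m. s j ^ e j)))"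

lemma bounded_poly_mono:
  assumes "bounded_poly m D p" "D \<le> D'"
  shows "bounded_poly m D' p"
proof -
  obtain c where c: "\<And>s. p s = (\<Sum>e\<in>exponents m D. c e * (\<Prod>j<m. s j ^ e j))"
    using assms(1) unfolding bounded_poly_def by blast
  have "p s = (\<Sum>e\<in>exponents m D'. (if e \<in> exponents m D then c e else 0) * (\<Prod>j<m. s j ^ e j))" for s
    unfolding c using exponents_mono[OF assms(2), of m]
    by (intro sum.mono_neutral_cong_left) auto
  then show ?thesis unfolding bounded_poly_def
    by (intro exI[of _ "\<lambda>e. if e \<in> exponents m D then c e else 0"]) blast
qed

lemma bounded_poly_add:
  assumes "bounded_poly m D p" "bounded_poly m D q"
  shows "bounded_poly m D (\<lambda>s. p s + q s)"
proof -
  obtain c d where "\<And>s. p s = (\<Sum>e\<in>exponents m D. c e * (\<Prod>j<m. s j ^ e j))"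
      "\<And>s. q s = (\<Sum>e\<in>exponents m D. d e * (\<Prod>j<m. s j ^ e j))"
    using assms unfolding bounded_poly_def by blast
  then have "p s + q s = (\<Sum>e\<in>exponents m D. (c e + d e) * (\<Prod>j<m. s j ^ e j))" for s
    by (simp add: distrib_right sum.distrib)
  then show ?thesis unfolding bounded_poly_def by (intro exI[of _ "\<lambda>e. c e + d e"]) blast
qed

lemma bounded_poly_mult:
  assumes "bounded_poly m D p" "bounded_poly m D' q"
  shows "bounded_poly m (D + D') (\<lambda>s. p s * q s)"
proof -
  obtain c d where cd: "\<And>s. p s = (\<Sum>e\<in>exponents m D. c e * (\<Prod>j<m. s j ^ e j))"
      "\<And>s. q s = (\<Sum>e\<in>exponents m D'. d e * (\<Prod>j<m. s j ^ e j))"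
    using assms unfolding bounded_poly_def by blast
  let ?X = "exponents m D \<times> exponents m D'"
  \<comment> \<open>Exponents must be \<open>undefined\<close> outside the first \<open>m\<close>
    places, which the pointwise sum need not be; hence \<open>restrict\<close>.\<close>
  define g where "g = (\<lambda>(a :: nat \<Rightarrow> nat, b). restrict (\<lambda>j. a j + b j) {..<m})"
  define h where "h e = (\<Sum>(a, b)\<in>{x \<in> ?X. g x = e}. c a * d b)" for e
  have sub: "g ` ?X \<subseteq> exponents m (D + D')"
    unfolding g_def exponents_def by (force intro: add_mono simp: PiE_iff)
  have "p s * q s = (\<Sum>e\<in>exponents m (D + D'). h e * (\<Prod>j<m. s j ^ e j))" for s
  proof -
    have "p s * q s = (\<Sum>(a, b)\<in>?X. c a * d b * (\<Prod>j<m. s j ^ g (a, b) j))"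
      unfolding cd sum_product sum.cartesian_product
      by (intro sum.cong refl)
        (auto simp: g_def power_add prod.distrib mult_ac)
    also have "\<dots> = (\<Sum>e\<in>exponents m (D + D'). \<Sum>x\<in>{x \<in> ?X. g x = e}.
        (case x of (a, b) \<Rightarrow> c a * d b * (\<Prod>j<m. s j ^ g (a, b) j)))"
      using sub by (intro sum.group[symmetric]) auto
    also have "\<dots> = (\<Sum>e\<in>exponents m (D + D'). h e * (\<Prod>j<m. s j ^ e j))"
      unfolding h_def sum_distrib_right by (intro sum.cong refl) auto
    finally show ?thesis .
  qed
  then show ?thesis unfolding bounded_poly_def by blast
qed

lemma bounded_poly_const: "bounded_poly m D (\<lambda>s. a)"
proof -
  have "bounded_poly m 0 (\<lambda>s. a)"
    unfolding bounded_poly_def exponents_def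
    by (intro exI[of _ "\<lambda>_. a"]) (auto simp: PiE_eq_singleton card_PiE prod.neutral)
  then show ?thesis using bounded_poly_mono by blast
qed

lemma bounded_poly_var:
  assumes "i < m"
  shows "bounded_poly m 1 (\<lambda>s. s i)"
proof -
  let ?d = "restrict (\<lambda>j. if j = i then 1 else 0) {..<m} :: nat \<Rightarrow> nat"
  have d: "?d \<in> exponents m 1" by (auto simp: exponents_def)
  have "s i = (\<Sum>e\<in>exponents m 1. (if e = ?d then 1 else 0) * (\<Prod>j<m. s j ^ e j))" for s :: "nat \<Rightarrow> complex"
  proof -
    have "(\<Prod>j<m. s j ^ ?d j) = (\<Prod>j<m. if j = i then s j else 1)"
      by (intro prod.cong) auto
    also have "\<dots> = s i" using assms by simp
    moreover have "(\<Sum>e\<in>exponents m 1. (if e = ?d then 1 else 0) * (\<Prod>j<m. s j ^ e j)) =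
        (\<Sum>e\<in>exponents m 1. if e = ?d then (\<Prod>j<m. s j ^ e j) else 0)"
      by (intro sum.cong) auto
    moreover have "\<dots> = (\<Prod>j<m. s j ^ ?d j)" using d by (subst sum.delta) auto
    ultimately show ?thesis by simp
  qed
  then show ?thesis unfolding bounded_poly_def
    by (intro exI[of _ "\<lambda>e. if e = ?d then 1 else 0"]) blast
qed

lemma polyn_imp_bounded_poly:
  assumes "p \<in> polyn m"
  shows "\<exists>D. bounded_poly m D p"
  using assms unfolding polyn_def
proof induction
  case (const a)
  show ?case using bounded_poly_const by blast
next
  case (gen b)
  then show ?case using bounded_poly_var by blast
next
  case (add p q)
  then obtain D D' where "bounded_poly m D p" "bounded_poly m D' q" by blast
  then have "bounded_poly m (max D D') p" "bounded_poly m (max D D') q"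
    by (auto intro: bounded_poly_mono)
  then show ?case using bounded_poly_add by blast
next
  case (mult p q)
  then show ?case using bounded_poly_mult by blast
qed

lemma bounded_poly_power:
  "bounded_poly m D p \<Longrightarrow> n \<le> N \<Longrightarrow> bounded_poly m (N * D) (\<lambda>s. p s ^ n)"
proof (induction n arbitrary: N)
  case 0
  then show ?case by (simp add: bounded_poly_const)
next
  case (Suc n)
  then obtain N' where "N = Suc N'" "n \<le> N'" by (metis Suc_le_D Suc_le_mono)
  then show ?case using bounded_poly_mult[OF Suc.prems(1) Suc.IH[of N']] Suc.prems by simp
qed

lemma bounded_poly_prod:
  "finite I \<Longrightarrow> (\<And>i. i \<in> I \<Longrightarrow> bounded_poly m D (p i)) \<Longrightarrow>
   bounded_poly m (card I * D) (\<lambda>s. \<Prod>i\<in>I. p i s)"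
  by (induction I rule: finite_induct) (auto simp: bounded_poly_const bounded_poly_mult)

text \<open>There are \<open>(N + 1)\<^sup>k\<close> monomials of degree at most \<open>N\<close> in each of the \<open>k\<close> functions, and
  they lie in a space of dimension \<open>(k N D + 1)\<^sup>m\<close>, where \<open>D\<close> bounds the degrees.\<close>

lemma not_alg_indep_polyn:
  assumes f: "\<And>j. j < k \<Longrightarrow> f j \<in> polyn m" and "m < k"
  shows "\<not> alg_indep k f UNIV"
proof -
  have "\<forall>j. \<exists>D. j < k \<longrightarrow> bounded_poly m D (f j)" using f polyn_imp_bounded_poly by blast
  then obtain d where d: "\<And>j. j < k \<Longrightarrow> bounded_poly m (d j) (f j)" by metis
  define D where "D = Max (insert 1 (d ` {..<k}))"
  have D: "bounded_poly m D (f j)" if "j < k" for j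
    using bounded_poly_mono[OF d[OF that]] that unfolding D_def by simp
  have "D \<ge> 1" unfolding D_def by simp
  \<comment> \<open>Chosen such that the factor \<open>(k * D + 1) ^ m\<close> becomes
    \<open>N\<close> itself: the dimension is then at most \<open>N * Suc N ^ m\<close>, which is
    less than \<open>Suc N ^ Suc m\<close>.\<close>
  define N where "N = (k * D + 1) ^ m"
  let ?L = "k * (N * D)"
  have "Suc ?L ^ m < Suc N ^ k"
  proof -
    have "Suc ?L \<le> (k * D + 1) * Suc N" by (simp add: algebra_simps)
    then have "Suc ?L ^ m \<le> ((k * D + 1) * Suc N) ^ m" by (rule power_mono) simp
    also have "\<dots> = N * Suc N ^ m" by (simp only: power_mult_distrib N_def)
    also have "\<dots> < Suc N ^ Suc m" by simp
    also have "\<dots> \<le> Suc N ^ k" using \<open>m < k\<close> by (intro power_increasing) auto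
    finally show ?thesis .
  qed
  then have card: "card (exponents m ?L) < card (exponents k N)" by (simp only: card_exponents)
  have "bounded_poly m ?L (\<lambda>s. \<Prod>j<k. f j s ^ e j)" if "e \<in> exponents k N" for e
    using bounded_poly_prod[of "{..<k}" m "N * D" "\<lambda>j s. f j s ^ e j"] that
      bounded_poly_power[OF D] by (auto simp: exponents_def PiE_iff)
  then have "\<forall>e\<in>exponents k N. \<exists>c.
      (\<forall>s. (\<Prod>j<k. f j s ^ e j) = (\<Sum>a\<in>exponents m ?L. c a * (\<Prod>j<m. s j ^ a j)))"
    unfolding bounded_poly_def by blast
  then obtain M where M: "\<And>e s. e \<in> exponents k N \<Longrightarrow>
      (\<Prod>j<k. f j s ^ e j) = (\<Sum>a\<in>exponents m ?L. M e a * (\<Prod>j<m. s j ^ a j))"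
    by (auto dest!: bchoice)
  obtain x e0 where x: "e0 \<in> exponents k N" "x e0 \<noteq> 0"
    "\<And>a. a \<in> exponents m ?L \<Longrightarrow> (\<Sum>e\<in>exponents k N. x e * M e a) = 0"
    using exists_nontrivial_solution[OF finite_exponents finite_exponents card, of M] by blast
  have "(\<Sum>e\<in>exponents k N. x e * (\<Prod>j<k. f j s ^ e j)) = 0" for s
  proof -
    have "(\<Sum>e\<in>exponents k N. x e * (\<Prod>j<k. f j s ^ e j)) =
        (\<Sum>e\<in>exponents k N. \<Sum>a\<in>exponents m ?L. x e * M e a * (\<Prod>j<m. s j ^ a j))"
      by (intro sum.cong refl) (simp add: M sum_distrib_left mult.assoc)
    also have "\<dots> = (\<Sum>a\<in>exponents m ?L. (\<Sum>e\<in>exponents k N. x e * M e a) * (\<Prod>j<m. s j ^ a j))"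
      by (subst sum.swap) (simp add: sum_distrib_right)
    finally show ?thesis using x(3) by simp
  qed
  then show ?thesis using x(1,2) unfolding alg_indep_def by blast
qed

text \<open>The chain is the flag of coordinate subspaces: coordinate \<open>i\<close> vanishes on
  \<open>?Z i\<close> but not on \<open>?Z (Suc i)\<close>. Each subspace is irreducible as the
  image of the whole space under the projection that sets the remaining coordinates to zero.\<close>

lemma alg_indep_coordinates: "alg_indep k (\<lambda>j s. s j) UNIV"
proof -
  let ?Z = "\<lambda>i. {s :: nat \<Rightarrow> complex. \<forall>j. i \<le> j \<and> j < k \<longrightarrow> s j = 0}"
  have line: "integral_on (alg_gen {\<lambda>s. s j | j. j < k}) (?Z i)" for i
  proof -
    let ?\<rho> = "\<lambda>s j. if i \<le> j \<and> j < k then 0 else s j :: complex"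
    have Z: "?Z i = range ?\<rho>"
    proof
      show "?Z i \<subseteq> range ?\<rho>"
      proof
        fix s assume "s \<in> ?Z i"
        then have "s = ?\<rho> s" by auto
        then show "s \<in> range ?\<rho>" by blast
      qed
    qed auto
    have "(\<lambda>s. p (?\<rho> s)) \<in> polyn k" if "p \<in> alg_gen {\<lambda>s. s j | j. j < k}" for p
      unfolding polyn_def
    proof (rule alg_gen_compose[OF that])
      fix b :: "(nat \<Rightarrow> complex) \<Rightarrow> complex" assume "b \<in> {\<lambda>s. s j | j. j < k}"
      then obtain j where "b = (\<lambda>s. s j)" "j < k" by blast
      then show "(\<lambda>s. b (?\<rho> s)) \<in> alg_gen {\<lambda>s. s j | j. j < k}"
        by (cases "i \<le> j") (simp_all add: alg_gen.const, blast intro: alg_gen.gen)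
    qed
    then show ?thesis
      using integral_on_polyn[of k] unfolding integral_on_def Z by (auto 0 3)
  qed
  have "alg_indep k (\<lambda>j s. s j) (?Z k)"
  proof (rule alg_indep_chain[where Z = ?Z and B = "{\<lambda>s. s j | j. j < k}"])
    fix i assume "i < k"
    show "\<exists>x\<in>?Z (Suc i). x i \<noteq> 0"
      by (intro bexI[of _ "\<lambda>j. if j = i then 1 else 0"]) auto
    show "integral_on (alg_gen {\<lambda>s. s j | j. j < k}) (?Z (Suc i))" by (rule line)
    show "(\<lambda>s. s i) \<in> alg_gen {\<lambda>s. s j | j. j < k}"
      using \<open>i < k\<close> by (blast intro: alg_gen.gen)
  qed auto
  moreover have "?Z k = UNIV" by auto
  ultimately show ?thesis by simp
qed

subsection \<open>Zariski closed sets and dimension\<close>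

text \<open>Induction over the generation of open sets: an intersection of two open sets corresponds
  to the pairwise products of the equations of the complements, a union to the union of the families
  of equations.\<close>

lemma closedin_zariski_iff:
  fixes Z :: "(complex ^ 'n ^ 'n) set"
  shows "closedin zariski_topology Z \<longleftrightarrow> (\<exists>S\<subseteq>poly_functions. Z = {A. \<forall>p\<in>S. p A = 0})"
proof -
  have top: "topspace zariski_topology = (UNIV :: (complex ^ 'n ^ 'n) set)"
  proof -
    have "(UNIV :: (complex ^ 'n ^ 'n) set) \<in> {{A. p A \<noteq> 0} | p. p \<in> poly_functions}"
      by (intro CollectI exI[of _ "\<lambda>_. 1"]) (simp add: poly_functions.const)
    then show ?thesis unfolding zariski_topology_def by auto
  qed
  have gen: "\<exists>S\<subseteq>poly_functions. - U = {A. \<forall>p\<in>S. p A = 0}"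
    if "generate_topology_on {{A. p A \<noteq> 0} | p. p \<in> poly_functions} U"
    for U :: "(complex ^ 'n ^ 'n) set"
    using that
    proof induction
      case Empty
      show ?case by (intro exI[of _ "{}"]) auto
    next
      case (Int a b)
      then obtain S T where S: "S \<subseteq> poly_functions" "- a = {A. \<forall>p\<in>S. p A = 0}"
        and T: "T \<subseteq> poly_functions" "- b = {A. \<forall>p\<in>T. p A = 0}" by blast
      let ?R = "{\<lambda>A. p A * q A | p q. p \<in> S \<and> q \<in> T}"
      have "- (a \<inter> b) = {A. \<forall>p\<in>?R. p A = 0}"
        unfolding Compl_Int S(2) T(2) by (auto 0 4)
      moreover have "?R \<subseteq> poly_functions"
        using S(1) T(1) by (auto intro!: poly_functions.mult)
      ultimately show ?case by blast
    next
      case (UN K)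
      then have "\<forall>k\<in>K. \<exists>S. S \<subseteq> poly_functions \<and> - k = {A. \<forall>p\<in>S. p A = 0}" by simp
      from bchoice[OF this] obtain S
        where S: "\<forall>k\<in>K. S k \<subseteq> poly_functions \<and> - k = {A. \<forall>p\<in>S k. p A = 0}" ..
      have "- \<Union>K = (\<Inter>k\<in>K. - k)" by blast
      also have "\<dots> = (\<Inter>k\<in>K. {A. \<forall>p\<in>S k. p A = 0})" using S by simp
      also have "\<dots> = {A. \<forall>p\<in>\<Union>(S ` K). p A = 0}" by blast
      finally have "- \<Union>K = {A. \<forall>p\<in>\<Union>(S ` K). p A = 0}" .
      moreover have "\<Union>(S ` K) \<subseteq> poly_functions" using S by blast
      ultimately show ?case by blast
    next
      case (Basis s)
      then obtain p where "s = {A. p A \<noteq> 0}" "p \<in> poly_functions" by blast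
      then show ?case by (intro exI[of _ "{p}"]) auto
    qed
  show ?thesis
  proof
    assume "closedin zariski_topology Z"
    then have "generate_topology_on {{A. p A \<noteq> 0} | p. p \<in> poly_functions} (- Z)"
      unfolding closedin_def top Compl_eq_Diff_UNIV[symmetric]
      by (simp add: zariski_topology_def openin_topology_generated_by_iff)
    from gen[OF this] show "\<exists>S\<subseteq>poly_functions. Z = {A. \<forall>p\<in>S. p A = 0}" by simp
  next
    assume "\<exists>S\<subseteq>poly_functions. Z = {A. \<forall>p\<in>S. p A = 0}"
  then obtain S where S: "S \<subseteq> poly_functions" "Z = {A. \<forall>p\<in>S. p A = 0}" by blast
  have "UNIV - Z = \<Union>((\<lambda>p. {A. p A \<noteq> 0}) ` S)" using S by auto
  moreover have "openin zariski_topology {A. p A \<noteq> 0}" if "p \<in> S" for p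
    using that S(1) unfolding zariski_topology_def
    by (intro topology_generated_by_Basis) auto
  ultimately show "closedin zariski_topology Z"
    unfolding closedin_def top by auto
  qed
qed

lemma closedin_zariski_zeros:
  "p \<in> poly_functions \<Longrightarrow> closedin zariski_topology {A. p A = 0}"
  unfolding closedin_zariski_iff by (intro exI[of _ "{p}"]) auto

lemma topspace_zariski [simp]: "topspace zariski_topology = UNIV"
  using closedin_zariski_zeros[OF poly_functions.const[of 0]] closedin_subset by fastforce

definition zeros_on :: "(complex ^ 'n ^ 'n \<Rightarrow> complex) \<Rightarrow> (complex ^ 'n ^ 'n) set \<Rightarrow> bool" where
  "zeros_on p T \<longleftrightarrow> (\<forall>A\<in>T. p A = 0)"

lemma zariski_closure_eq:
  "zariski_topology closure_of T = {A. \<forall>p\<in>poly_functions. zeros_on p T \<longrightarrow> p A = 0}" (is "_ = ?R")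
proof
  have "closedin zariski_topology ?R"
    unfolding closedin_zariski_iff
    by (intro exI[of _ "{p \<in> poly_functions. zeros_on p T}"]) auto
  then show "zariski_topology closure_of T \<subseteq> ?R"
    by (intro closure_of_minimal) (auto simp: zeros_on_def)
  have "closedin zariski_topology (zariski_topology closure_of T)" by simp
  then obtain S where S: "S \<subseteq> poly_functions" "zariski_topology closure_of T = {A. \<forall>p\<in>S. p A = 0}"
    unfolding closedin_zariski_iff by blast
  have "T \<subseteq> zariski_topology closure_of T" by (simp add: closure_of_subset)
  then have "zeros_on p T" if "p \<in> S" for p using S(2) that by (auto simp: zeros_on_def)
  then show "?R \<subseteq> zariski_topology closure_of T" unfolding S(2) using S(1) by auto
qed

lemma zariski_dim_cong:
  assumes "\<And>p. p \<in> poly_functions \<Longrightarrow> zeros_on p T \<longleftrightarrow> zeros_on p T'"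
  shows "zariski_dim T = zariski_dim T'"
proof -
  have "zariski_topology closure_of T = zariski_topology closure_of T'"
    unfolding zariski_closure_eq using assms by auto
  then show ?thesis unfolding zariski_dim_def by simp
qed

text \<open>The correspondence between irreducible closed sets and prime vanishing ideals, relative
  to a closed subspace because \<open>zariski_dim\<close> is the Krull dimension of a
  closure.\<close>

lemma irreducible_closedin_iff:
  assumes "closedin zariski_topology V"
  shows "irreducible_closedin (subtopology zariski_topology V) Z \<longleftrightarrow>
    closedin zariski_topology Z \<and> Z \<subseteq> V \<and> Z \<noteq> {} \<and> integral_on poly_functions Z" (is "?L \<longleftrightarrow> ?R")
proof
  note cl = closedin_closed_subtopology[OF assms]
  assume L: ?L
  then have Z: "closedin zariski_topology Z" "Z \<subseteq> V" "Z \<noteq> {}"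
    unfolding irreducible_closedin_def cl by auto
  have "integral_on poly_functions Z"
    unfolding integral_on_def
  proof (intro ballI impI)
    fix p q assume pq: "p \<in> poly_functions" "q \<in> poly_functions" "\<forall>x\<in>Z. p x * q x = 0"
    have "closedin zariski_topology (Z \<inter> {A. p A = 0})" "closedin zariski_topology (Z \<inter> {A. q A = 0})"
      using Z(1) pq by (auto intro!: closedin_Int closedin_zariski_zeros)
    moreover have "Z = (Z \<inter> {A. p A = 0}) \<union> (Z \<inter> {A. q A = 0})" using pq(3) by auto
    ultimately have "Z = Z \<inter> {A. p A = 0} \<or> Z = Z \<inter> {A. q A = 0}"
      using L Z(2) unfolding irreducible_closedin_def cl by (meson inf.coboundedI1)
    then show "(\<forall>x\<in>Z. p x = 0) \<or> (\<forall>x\<in>Z. q x = 0)" by blast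
  qed
  with Z show ?R by simp
next
  note cl = closedin_closed_subtopology[OF assms]
  assume R: ?R
  have "Z = A \<or> Z = B" if AB: "closedin zariski_topology A" "closedin zariski_topology B" "Z = A \<union> B" for A B
  proof (rule ccontr)
    assume "\<not> (Z = A \<or> Z = B)"
    then obtain a b where ab: "a \<in> Z" "a \<notin> A" "b \<in> Z" "b \<notin> B" using AB(3) by blast
    obtain S T where S: "S \<subseteq> poly_functions" "A = {A. \<forall>p\<in>S. p A = 0}"
      and T: "T \<subseteq> poly_functions" "B = {A. \<forall>p\<in>T. p A = 0}"
      using AB(1,2) unfolding closedin_zariski_iff by blast
    then obtain p q where pq: "p \<in> S" "p a \<noteq> 0" "q \<in> T" "q b \<noteq> 0" using ab by blast
    then have "p x * q x = 0" if "x \<in> Z" for x using that AB(3) S T by auto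
    then have "(\<forall>x\<in>Z. p x = 0) \<or> (\<forall>x\<in>Z. q x = 0)"
      using R pq S(1) T(1) integral_onD by blast
    then show False using pq ab by blast
  qed
  with R show ?L unfolding irreducible_closedin_def cl by blast
qed

lemma integral_on_closure:
  assumes "integral_on poly_functions T"
  shows "integral_on poly_functions (zariski_topology closure_of T)"
  unfolding integral_on_def
proof (intro ballI impI)
  fix p q assume pq: "p \<in> poly_functions" "q \<in> poly_functions"
    "\<forall>x\<in>zariski_topology closure_of T. p x * q x = 0"
  have "T \<subseteq> zariski_topology closure_of T" by (simp add: closure_of_subset)
  then have "(\<forall>x\<in>T. p x = 0) \<or> (\<forall>x\<in>T. q x = 0)"
    using integral_onD[OF assms pq(1,2)] pq(3) by blast
  then show "(\<forall>x\<in>zariski_topology closure_of T. p x = 0) \<or>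
      (\<forall>x\<in>zariski_topology closure_of T. q x = 0)"
    unfolding zariski_closure_eq zeros_on_def using pq by blast
qed

text \<open>A chain of length \<open>k\<close> provides \<open>k\<close> functions that are
  independent on its largest member. A relation between their pullbacks along \<open>\<phi>\<close>
  would hold on the image, hence on the closure of \<open>T\<close>; so the pullbacks are
  independent polynomials in \<open>m\<close> variables. The second assumption says that
  \<open>T\<close> lies in the closure of the image, which allows a parametrisation that misses some
  points of \<open>T\<close>.\<close>

lemma zariski_dim_le:
  fixes \<phi> :: "(nat \<Rightarrow> complex) \<Rightarrow> complex ^ 'n ^ 'n"
  assumes \<phi>: "\<And>i j. (\<lambda>s. \<phi> s $ i $ j) \<in> polyn m"
    and T: "\<And>p. p \<in> poly_functions \<Longrightarrow> zeros_on p (range \<phi>) \<Longrightarrow> zeros_on p T"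
  shows "zariski_dim T \<le> enat m"
  unfolding zariski_dim_def krull_dim_def
proof (rule Sup_least, clarify)
  let ?V = "zariski_topology closure_of T"
  fix k and Z :: "nat \<Rightarrow> (complex ^ 'n ^ 'n) set"
  assume irr: "\<forall>i\<le>k. irreducible_closedin (subtopology zariski_topology ?V) (Z i)"
    and strict: "\<forall>i<k. Z i \<subset> Z (Suc i)"
  have Z: "closedin zariski_topology (Z i)" "Z i \<subseteq> ?V" "Z i \<noteq> {}" "integral_on poly_functions (Z i)"
    if "i \<le> k" for i
    using irr that by (auto simp: irreducible_closedin_iff)
  have "\<exists>f\<in>poly_functions. zeros_on f (Z i) \<and> (\<exists>x\<in>Z (Suc i). f x \<noteq> 0)" if "i < k" for i
  proof -
    have "closedin zariski_topology (Z i)" using that by (intro Z(1)) simp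
    then obtain S where S: "S \<subseteq> poly_functions" "Z i = {A. \<forall>p\<in>S. p A = 0}"
      unfolding closedin_zariski_iff by blast
    have "Z i \<subset> Z (Suc i)" using strict that by blast
    then obtain x where x: "x \<in> Z (Suc i)" "x \<notin> Z i" by blast
    then obtain p where p: "p \<in> S" "p x \<noteq> 0" using S(2) by auto
    then have "zeros_on p (Z i)" using S(2) by (simp add: zeros_on_def)
    then show ?thesis using p S(1) x(1) by (intro bexI[of _ p]) auto
  qed
  then obtain f where f: "\<And>i. i < k \<Longrightarrow> f i \<in> poly_functions" "\<And>i. i < k \<Longrightarrow> zeros_on (f i) (Z i)"
    "\<And>i. i < k \<Longrightarrow> \<exists>x\<in>Z (Suc i). f i x \<noteq> 0"
    by metis
  have ind: "alg_indep k f (Z k)"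
    using f Z strict
    by (intro alg_indep_chain[where B = "matrix_entries"])
      (auto simp: zeros_on_def simp flip: poly_functions_eq_alg_gen)
  have "alg_indep k (\<lambda>j s. f j (\<phi> s)) UNIV"
  proof (rule alg_indepI)
    fix N c e
    assume rel: "\<And>x. x \<in> UNIV \<Longrightarrow> (\<Sum>e\<in>exponents k N. c e * (\<Prod>j<k. f j (\<phi> x) ^ e j)) = 0"
      and e: "e \<in> exponents k N"
    let ?P = "\<lambda>x. \<Sum>e\<in>exponents k N. c e * (\<Prod>j<k. f j x ^ e j)"
    have "?P \<in> poly_functions"
      using f(1) unfolding poly_functions_eq_alg_gen
      by (intro alg_gen_sum alg_gen.mult alg_gen.const alg_gen_prod alg_gen_power) auto
    moreover have "zeros_on ?P (range \<phi>)" using rel by (auto simp: zeros_on_def)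
    ultimately have "?P x = 0" if "x \<in> ?V" for x
      using T that unfolding zariski_closure_eq by blast
    then show "c e = 0" using alg_indepD[OF ind _ e, of c] Z(2) by blast
  qed
  moreover have "(\<lambda>s. f j (\<phi> s)) \<in> polyn m" if "j < k" for j
    using poly_functions_compose[OF f(1)[OF that], of \<phi>] \<phi> unfolding polyn_def by blast
  ultimately have "k \<le> m" using not_alg_indep_polyn[of k "\<lambda>j s. f j (\<phi> s)" m] by fastforce
  then show "enat k \<le> enat m" by simp
qed

text \<open>The projection of the parameter space to the \<open>i\<close>-dimensional coordinate
  subspace through \<open>s0\<close>.\<close>

definition freeze :: "(nat \<Rightarrow> complex) \<Rightarrow> nat \<Rightarrow> (nat \<Rightarrow> complex) \<Rightarrow> nat \<Rightarrow> complex" where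
  "freeze s0 i s = (\<lambda>j. if j < i then s j else s0 j)"

lemma polyn_freeze:
  assumes "p \<in> polyn m"
  shows "(\<lambda>s. p (freeze s0 i s)) \<in> polyn i"
  using assms unfolding polyn_def
proof (rule alg_gen_compose)
  fix b :: "(nat \<Rightarrow> complex) \<Rightarrow> complex" assume "b \<in> {\<lambda>s. s j | j. j < m}"
  then obtain j where "b = (\<lambda>s. s j)" by blast
  then show "(\<lambda>s. b (freeze s0 i s)) \<in> alg_gen {\<lambda>s. s j | j. j < i}"
    by (cases "j < i") (simp_all add: freeze_def alg_gen.const, blast intro: alg_gen.gen)
qed

text \<open>The chain consists of the closures of the images of the coordinate subspaces through \<open>s0\<close>;
  it is strict because \<open>i + 1\<close> functions are algebraically dependent on an image of
  \<open>i\<close>-dimensional space.\<close>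

lemma zariski_dim_ge:
  fixes \<psi> :: "(nat \<Rightarrow> complex) \<Rightarrow> complex ^ 'n ^ 'n"
  assumes \<psi>: "\<And>i j. (\<lambda>s. \<psi> s $ i $ j) \<in> polyn M" and T: "\<And>s. \<psi> s \<in> T"
    and F: "\<And>j. j < m \<Longrightarrow> F j \<in> poly_functions"
    and ind: "\<And>i. i \<le> m \<Longrightarrow> alg_indep i (\<lambda>j s. F j (\<psi> (freeze s0 i s))) UNIV"
  shows "enat m \<le> zariski_dim T"
proof -
  let ?V = "zariski_topology closure_of T"
  define Z where "Z i = zariski_topology closure_of (range (\<lambda>s. \<psi> (freeze s0 i s)))" for i
  have poly: "(\<lambda>s. p (\<psi> (freeze s0 i s))) \<in> polyn i" if "p \<in> poly_functions" for p i
  proof -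
    have "(\<lambda>s. p (\<psi> s)) \<in> polyn M"
      using poly_functions_compose[OF that, of \<psi>] \<psi> unfolding polyn_def by blast
    then show ?thesis by (rule polyn_freeze)
  qed
  have irr: "irreducible_closedin (subtopology zariski_topology ?V) (Z i)" for i
  proof (subst irreducible_closedin_iff, simp, intro conjI)
    show "closedin zariski_topology (Z i)" unfolding Z_def by simp
    show "Z i \<subseteq> ?V" unfolding Z_def by (intro closure_of_mono) (use T in auto)
    show "Z i \<noteq> {}" unfolding Z_def by (simp add: closure_of_eq_empty_gen disjnt_def)
    have "integral_on poly_functions (range (\<lambda>s. \<psi> (freeze s0 i s)))"
      unfolding integral_on_def
    proof (intro ballI impI)
      fix p q assume "p \<in> poly_functions" "q \<in> poly_functions"
        "\<forall>x\<in>range (\<lambda>s. \<psi> (freeze s0 i s)). p x * q x = 0"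
      then show "(\<forall>x\<in>range (\<lambda>s. \<psi> (freeze s0 i s)). p x = 0) \<or>
          (\<forall>x\<in>range (\<lambda>s. \<psi> (freeze s0 i s)). q x = 0)"
        using integral_onD[OF integral_on_polyn poly[of p i] poly[of q i]] by auto
    qed
    then show "integral_on poly_functions (Z i)" unfolding Z_def by (rule integral_on_closure)
  qed
  have "Z i \<subset> Z (Suc i)" if "i < m" for i
  proof
    have "freeze s0 i s = freeze s0 (Suc i) (freeze s0 i s)" for s
      by (auto simp: freeze_def)
    then have "range (\<lambda>s. \<psi> (freeze s0 i s)) \<subseteq> range (\<lambda>s. \<psi> (freeze s0 (Suc i) s))"
      by (metis image_subsetI rangeI)
    then show "Z i \<subseteq> Z (Suc i)" unfolding Z_def by (rule closure_of_mono)
    have "\<not> alg_indep (Suc i) (\<lambda>j s. F j (\<psi> (freeze s0 i s))) UNIV"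
      by (rule not_alg_indep_polyn[of _ _ i]) (use that in \<open>auto intro!: poly F\<close>)
    then obtain N c e where e: "e \<in> exponents (Suc i) N" "c e \<noteq> 0"
      and rel: "\<And>s. (\<Sum>e\<in>exponents (Suc i) N. c e * (\<Prod>j<Suc i. F j (\<psi> (freeze s0 i s)) ^ e j)) = 0"
      unfolding alg_indep_def by blast
    let ?P = "\<lambda>x. \<Sum>e\<in>exponents (Suc i) N. c e * (\<Prod>j<Suc i. F j x ^ e j)"
    have "?P \<in> poly_functions"
      using F that unfolding poly_functions_eq_alg_gen
      by (intro alg_gen_sum alg_gen.mult alg_gen.const alg_gen_prod alg_gen_power) auto
    moreover have "zeros_on ?P (range (\<lambda>s. \<psi> (freeze s0 i s)))"
      using rel by (auto simp: zeros_on_def)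
    ultimately have P0: "?P x = 0" if "x \<in> Z i" for x
      using that unfolding Z_def zariski_closure_eq by blast
    show "Z i \<noteq> Z (Suc i)"
    proof
      assume eq: "Z i = Z (Suc i)"
      have "range (\<lambda>s. \<psi> (freeze s0 (Suc i) s)) \<subseteq> Z (Suc i)"
        unfolding Z_def by (simp add: closure_of_subset)
      then have "\<psi> (freeze s0 (Suc i) s) \<in> Z i" for s unfolding eq by blast
      then have "?P (\<psi> (freeze s0 (Suc i) s)) = 0" for s by (rule P0)
      moreover have "Suc i \<le> m" using that by simp
      ultimately have "c e = 0" by (intro alg_indepD[where c = c, OF ind _ e(1)])
      with e show False by simp
    qed
  qed
  then show ?thesis
    unfolding zariski_dim_def krull_dim_def
    by (intro Sup_upper) (use irr in auto)
qed

subsection \<open>Real points are dense\<close>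

text \<open>On the complex line Re A + z Im A the matrix is real for real z, and it is A for z =
  \<i>. A polynomial in z with infinitely many zeros is zero.\<close>

lemma poly_function_zero_of_real:
  fixes A :: "complex ^ 'n ^ 'n"
  assumes p: "p \<in> poly_functions" and zero: "\<And>A :: complex ^ 'n ^ 'n. (\<And>i j. A $ i $ j \<in> \<real>) \<Longrightarrow> p A = 0"
  shows "p A = 0"
proof -
  let ?\<gamma> = "\<lambda>z. \<chi> i j. of_real (Re (A $ i $ j)) + z * of_real (Im (A $ i $ j))"
  have "\<exists>P. \<forall>z. p (?\<gamma> z) = poly P z"
  proof (rule alg_gen_along_curve[where \<gamma> = ?\<gamma> and B = matrix_entries])
    show "p \<in> alg_gen matrix_entries" using p by (simp only: poly_functions_eq_alg_gen)
    fix b :: "complex ^ 'n ^ 'n \<Rightarrow> complex" assume "b \<in> matrix_entries"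
    then obtain i j where "b = (\<lambda>A. A $ i $ j)" unfolding matrix_entries_def by blast
    then have "b (?\<gamma> z) = poly [:of_real (Re (A $ i $ j)), of_real (Im (A $ i $ j)):] z" for z
      by simp
    then show "\<exists>P. \<forall>z. b (?\<gamma> z) = poly P z" by blast
  qed
  then obtain P where P: "\<And>z. p (?\<gamma> z) = poly P z" by blast
  have "\<real> \<subseteq> {z. poly P z = 0}"
  proof
    fix z :: complex assume "z \<in> \<real>"
    then have "p (?\<gamma> z) = 0" by (intro zero) (auto intro!: Reals_add Reals_mult)
    then show "z \<in> {z. poly P z = 0}" using P by simp
  qed
  moreover have "infinite (\<real> :: complex set)"
    unfolding Reals_def using infinite_UNIV_char_0[where 'a = real]
    by (metis finite_imageD inj_of_real)
  ultimately have "P = 0" using poly_roots_finite finite_subset by blast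
  then have "p (?\<gamma> \<i>) = 0" using P by simp
  moreover have "?\<gamma> \<i> = A" by (simp add: vec_eq_iff complex_eq_iff)
  ultimately show ?thesis by simp
qed

lemma det_in_Reals:
  fixes A :: "complex ^ 'n ^ 'n"
  assumes "\<And>i j. A $ i $ j \<in> \<real>"
  shows "det A \<in> \<real>"
  unfolding det_def using assms
  by (intro sum_in_Reals Reals_mult prod_in_Reals) auto

text \<open>A rational retraction of the invertible matrices onto the special linear group that is
  defined over the reals. It carries density of real points from the affine space of matrices to the
  group.\<close>

definition row_normalised :: "'n \<Rightarrow> complex ^ 'n ^ 'n \<Rightarrow> complex ^ 'n ^ 'n" where
  "row_normalised k A = (\<chi> i. if i = k then (1 / det A) *s A $ i else A $ i)"

lemma det_row_normalised: "det A \<noteq> 0 \<Longrightarrow> det (row_normalised k A) = 1"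
proof -
  assume "det A \<noteq> 0"
  have "det (row_normalised k A) = 1 / det A * det (\<chi> i. if i = k then A $ i else A $ i)"
    unfolding row_normalised_def by (rule det_row_mul)
  then show ?thesis using \<open>det A \<noteq> 0\<close> by simp
qed

lemma poly_function_row_normalised:
  assumes "p \<in> poly_functions"
  shows "\<exists>G\<in>poly_functions. \<exists>d. \<forall>A. det A \<noteq> 0 \<longrightarrow> G A = det A ^ d * p (row_normalised k A)"
  using assms
proof induction
  case (const a)
  show ?case by (intro bexI[of _ "\<lambda>A. a"] exI[of _ 0]) (auto intro: poly_functions.const)
next
  case (entry i j)
  show ?case
  proof (cases "i = k")
    case True
    then show ?thesis
      by (intro bexI[of _ "\<lambda>A. A $ i $ j"] exI[of _ 1])
        (auto intro: poly_functions.entry simp: row_normalised_def)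
  next
    case False
    then show ?thesis
      by (intro bexI[of _ "\<lambda>A. A $ i $ j"] exI[of _ 0])
        (auto intro: poly_functions.entry simp: row_normalised_def)
  qed
next
  case (add p q)
  then obtain G d H e where G: "G \<in> poly_functions" "H \<in> poly_functions"
    "\<And>A. det A \<noteq> 0 \<Longrightarrow> G A = det A ^ d * p (row_normalised k A)"
    "\<And>A. det A \<noteq> 0 \<Longrightarrow> H A = det A ^ e * q (row_normalised k A)" by blast
  have det: "(\<lambda>A. det A ^ n) \<in> poly_functions" for n
    unfolding poly_functions_eq_alg_gen by (intro alg_gen_power alg_gen_det) (rule entry_in_alg_gen)
  show ?case
    by (intro bexI[of _ "\<lambda>A. det A ^ e * G A + det A ^ d * H A"] exI[of _ "d + e"])
      (auto intro!: poly_functions.intros det G(1,2) simp: G(3,4) power_add algebra_simps)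
next
  case (mult p q)
  then obtain G d H e where G: "G \<in> poly_functions" "H \<in> poly_functions"
    "\<And>A. det A \<noteq> 0 \<Longrightarrow> G A = det A ^ d * p (row_normalised k A)"
    "\<And>A. det A \<noteq> 0 \<Longrightarrow> H A = det A ^ e * q (row_normalised k A)" by blast
  show ?case
    by (intro bexI[of _ "\<lambda>A. G A * H A"] exI[of _ "d + e"])
      (auto intro!: poly_functions.intros G(1,2) simp: G(3,4) power_add algebra_simps)
qed

lemma SL_real_dense:
  assumes p: "p \<in> poly_functions" and zero: "zeros_on p (SL \<real>)"
  shows "zeros_on p (SL UNIV :: (complex ^ 'n ^ 'n) set)"
proof -
  obtain k :: 'n where True by blast
  obtain G d where G: "G \<in> poly_functions"
    "\<And>A. det A \<noteq> 0 \<Longrightarrow> G A = det A ^ d * p (row_normalised k A)"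
    using poly_function_row_normalised[OF p] by blast
  \<comment> \<open>Nothing is known about \<open>G\<close> at singular matrices; the extra factor
    \<open>det A\<close> makes the product vanish there as well.\<close>
  have "(\<lambda>A. det A * G A) \<in> poly_functions"
    using G(1) unfolding poly_functions_eq_alg_gen
    by (intro alg_gen.mult alg_gen_det entry_in_alg_gen)
  moreover have "det A * G A = 0" if "\<And>i j. A $ i $ j \<in> \<real>" for A
  proof (cases "det A = 0")
    case False
    then have "row_normalised k A \<in> SL \<real>"
      using that det_in_Reals[OF that]
      by (auto simp: SL_def det_row_normalised) (auto simp: row_normalised_def intro!: Reals_mult Reals_divide)
    then show ?thesis using G(2)[OF False] zero by (simp add: zeros_on_def)
  qed simp
  ultimately have 0: "det A * G A = 0" for A by (rule poly_function_zero_of_real)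
  show ?thesis unfolding zeros_on_def
  proof
    fix A :: "complex ^ 'n ^ 'n" assume "A \<in> SL UNIV"
    then have "det A = 1" by (simp add: SL_def)
    moreover have "row_normalised k A = A"
      using \<open>det A = 1\<close> by (simp add: row_normalised_def vec_eq_iff)
    ultimately show "p A = 0" using G(2)[of A] 0[of A] by simp
  qed
qed

section \<open>Polynomial inverses and density of real points under word maps\<close>

lemma matrix_inv_unique:
  fixes A B :: "'a::field ^ 'n ^ 'n"
  assumes "A ** B = mat 1"
  shows "matrix_inv A = B"
proof -
  have BA: "B ** A = mat 1" using assms matrix_left_right_inverse by blast
  have "A ** matrix_inv A = mat 1 \<and> matrix_inv A ** A = mat 1"
    unfolding matrix_inv_def by (rule someI[of _ B]) (use assms BA in simp)
  then have "matrix_inv A = (B ** A) ** matrix_inv A" "B ** (A ** matrix_inv A) = B"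
    using BA by (simp_all add: matrix_mul_rid matrix_mul_lid)
  then show ?thesis by (simp add: matrix_mul_assoc)
qed

lemma matrix_inv_right:
  fixes A :: "'a::field ^ 'n ^ 'n"
  assumes "invertible A"
  shows "A ** matrix_inv A = mat 1"
  using assms matrix_inv_unique[of A] unfolding invertible_def by metis

lemma matrix_inv_left:
  fixes A :: "'a::field ^ 'n ^ 'n"
  assumes "invertible A"
  shows "matrix_inv A ** A = mat 1"
  using matrix_inv_right[OF assms] matrix_left_right_inverse by blast

text \<open>The determinants of Cramer's rule for the unit vectors. They are polynomial on all
  matrices and give the inverse where the determinant is 1, so inverse letters become polynomial
  too.\<close>

definition adjugate :: "'a::field ^ 'n ^ 'n \<Rightarrow> 'a ^ 'n ^ 'n" where
  "adjugate A = (\<chi> k l. det (\<chi> i j. if j = k then axis l 1 $ i else A $ i $ j))"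

lemma matrix_inv_eq_adjugate:
  fixes A :: "'a::field ^ 'n ^ 'n"
  assumes "det A = 1"
  shows "matrix_inv A = adjugate A"
proof (rule matrix_inv_unique)
  have "A *v (\<chi> k. det (\<chi> i j. if j = k then axis l 1 $ i else A $ i $ j)) = axis l 1" for l
    using cramer[of A _ "axis l 1"] assms by simp
  then have "(\<Sum>k\<in>UNIV. A $ m $ k * adjugate A $ k $ l) = axis l 1 $ m" for m l
    unfolding adjugate_def matrix_vector_mult_def vec_eq_iff by simp
  then show "A ** adjugate A = mat 1"
    by (simp add: vec_eq_iff matrix_matrix_mult_def mat_def axis_def)
qed

lemma alg_gen_adjugate:
  assumes "\<And>i j. (\<lambda>x. A x $ i $ j) \<in> alg_gen B"
  shows "(\<lambda>x. adjugate (A x) $ k $ l) \<in> alg_gen B"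
proof -
  have "(\<lambda>x. (\<chi> i j. if j = k then axis l 1 $ i else A x $ i $ j) $ i $ j) \<in> alg_gen B" for i j
    by (cases "j = k") (auto intro: alg_gen.const assms)
  then show ?thesis unfolding adjugate_def by (simp add: alg_gen_det)
qed

text \<open>The word as a function of the single variable \<open>n\<close>, the others being fixed.
  An arbitrary accumulator \<open>A\<close> is needed for the induction, since it depends on
  \<open>X\<close> after the first letter.\<close>

lemma word_fold_poly:
  fixes ls :: "(nat \<times> bool \<times> (complex ^ 'n ^ 'n)) list"
  assumes "\<And>j k. (\<lambda>X. A X $ j $ k) \<in> poly_functions"
  shows "\<exists>\<Phi>. (\<forall>j k. (\<lambda>X. \<Phi> X $ j $ k) \<in> poly_functions) \<and>
    (\<forall>X\<in>SL UNIV. foldl (\<lambda>A (i, \<epsilon>, c). A ** (if \<epsilon> then (g(n := X)) i else matrix_inv ((g(n := X)) i)) ** c)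
       (A X) ls = \<Phi> X)"
  using assms
proof (induction ls arbitrary: A)
  case Nil
  then show ?case by auto
next
  case (Cons x ls)
  obtain i \<epsilon> c where x: "x = (i, \<epsilon>, c)" by (cases x)
  define S where "S X = (if i = n then if \<epsilon> then X else adjugate X
    else if \<epsilon> then g i else matrix_inv (g i))" for X
  have "(\<lambda>X. S X $ j $ k) \<in> alg_gen matrix_entries" for j k
    unfolding S_def by (cases "i = n"; cases \<epsilon>) (simp_all add: entry_in_alg_gen alg_gen_adjugate alg_gen.const)
  then have "(\<lambda>X. (A X ** S X ** c) $ j $ k) \<in> poly_functions" for j k
    using Cons.prems unfolding poly_functions_eq_alg_gen
    by (intro alg_gen_matrix_mult alg_gen.const)
  then obtain \<Phi> where \<Phi>: "\<And>j k. (\<lambda>X. \<Phi> X $ j $ k) \<in> poly_functions"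
    "\<And>X. X \<in> SL UNIV \<Longrightarrow> foldl (\<lambda>A (i, \<epsilon>, c). A ** (if \<epsilon> then (g(n := X)) i else matrix_inv ((g(n := X)) i)) ** c)
       (A X ** S X ** c) ls = \<Phi> X"
    using Cons.IH[of "\<lambda>X. A X ** S X ** c"] by blast
  have S: "(if \<epsilon> then (g(n := X)) i else matrix_inv ((g(n := X)) i)) = S X" if "X \<in> SL UNIV" for X
    using that by (auto simp: S_def SL_def matrix_inv_eq_adjugate)
  have "foldl (\<lambda>A (i, \<epsilon>, c). A ** (if \<epsilon> then (g(n := X)) i else matrix_inv ((g(n := X)) i)) ** c)
       (A X) (x # ls) = \<Phi> X" if "X \<in> SL UNIV" for X
    unfolding x foldl_Cons prod.case S[OF that] by (rule \<Phi>(2)[OF that])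
  with \<Phi>(1) show ?case by blast
qed

text \<open>Arguments are released from real to complex one at a time: the first \<open>k\<close>
  are already complex, the rest still real, and density of the real group is applied to a single
  argument.\<close>

lemma zeros_on_word_image_real_iff:
  fixes w :: "(complex ^ 'n ^ 'n) cword"
  assumes p: "p \<in> poly_functions"
  shows "zeros_on p (word_image w (SL \<real>) r) \<longleftrightarrow> zeros_on p (word_image w (SL UNIV) r)"
proof
  assume real: "zeros_on p (word_image w (SL \<real>) r)"
  have "p (word_eval w g) = 0" if "k \<le> r" "\<forall>i<k. g i \<in> SL UNIV" "\<forall>i. k \<le> i \<and> i < r \<longrightarrow> g i \<in> SL \<real>" for k g
    using that
  proof (induction k arbitrary: g)
    case 0
    then show ?case using real by (auto simp: zeros_on_def word_image_def)
  next
    case (Suc k)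
    have "\<exists>\<Phi>. (\<forall>j k'. (\<lambda>X. \<Phi> X $ j $ k') \<in> poly_functions) \<and>
        (\<forall>X\<in>SL UNIV. word_eval w (g(k := X)) = \<Phi> X)"
      unfolding word_eval_def by (rule word_fold_poly) (rule poly_functions.const)
    then obtain \<Phi> where \<Phi>: "\<And>j k'. (\<lambda>X. \<Phi> X $ j $ k') \<in> poly_functions"
      "\<And>X. X \<in> SL UNIV \<Longrightarrow> word_eval w (g(k := X)) = \<Phi> X"
      by auto
    have "(\<lambda>X. p (\<Phi> X)) \<in> poly_functions"
      using poly_functions_compose[OF p] \<Phi>(1) unfolding poly_functions_eq_alg_gen by blast
    moreover have "zeros_on (\<lambda>X. p (\<Phi> X)) (SL \<real>)"
      unfolding zeros_on_def
    proof
      fix X :: "complex ^ 'n ^ 'n" assume X: "X \<in> SL \<real>"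
      then have "X \<in> SL UNIV" by (simp add: SL_def)
      moreover have "\<forall>i. k \<le> i \<and> i < r \<longrightarrow> (g(k := X)) i \<in> SL \<real>"
        using Suc.prems(3) X by (auto simp: Suc_le_eq le_neq_implies_less)
      moreover have "p (word_eval w (g(k := X))) = 0"
        using Suc.prems X \<open>X \<in> SL UNIV\<close> calculation(2) by (intro Suc.IH) auto
      ultimately show "p (\<Phi> X) = 0" using \<Phi>(2) by simp
    qed
    ultimately have "zeros_on (\<lambda>X. p (\<Phi> X)) (SL UNIV)" by (rule SL_real_dense)
    moreover have "g k \<in> SL UNIV" using Suc.prems by simp
    ultimately show ?case using \<Phi>(2)[of "g k"] by (simp add: zeros_on_def)
  qed
  then have "p (word_eval w g) = 0" if "\<forall>i<r. g i \<in> SL UNIV" for g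
    using that by (meson leD order_refl)
  then show "zeros_on p (word_image w (SL UNIV) r)"
    by (auto simp: zeros_on_def word_image_def)
next
  show "zeros_on p (word_image w (SL UNIV) r) \<Longrightarrow> zeros_on p (word_image w (SL \<real>) r)"
    by (auto simp: zeros_on_def word_image_def SL_def)
qed

lemma zariski_dim_word_image_real:
  "zariski_dim (word_image w (SL \<real>) r) = zariski_dim (word_image w (SL UNIV) r)"
  by (rule zariski_dim_cong) (rule zeros_on_word_image_real_iff)

subsection \<open>Transvections\<close>

definition smat :: "complex \<Rightarrow> complex ^ 'n ^ 'm \<Rightarrow> complex ^ 'n ^ 'm" where
  "smat c A = (\<chi> i j. c * A $ i $ j)"

definition outer :: "complex ^ 'm \<Rightarrow> complex ^ 'n \<Rightarrow> complex ^ 'n ^ 'm" where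
  "outer v f = (\<chi> i j. v $ i * f $ j)"

definition transvection :: "complex \<Rightarrow> complex ^ 'n \<Rightarrow> complex ^ 'n \<Rightarrow> complex ^ 'n ^ 'n" where
  "transvection t v f = mat 1 + smat t (outer v f)"

lemma smat_nth [simp]: "smat c A $ i $ j = c * A $ i $ j"
  by (simp add: smat_def)

lemma outer_nth [simp]: "outer v f $ i $ j = v $ i * f $ j"
  by (simp add: outer_def)

lemma smat_smat [simp]: "smat c (smat d A) = smat (c * d) A"
  by (simp add: vec_eq_iff mult.assoc)

lemma smat_1 [simp]: "smat 1 A = A"
  by (simp add: vec_eq_iff)

lemma smat_mult_left [simp]: "smat c A ** B = smat c (A ** B)"
  by (simp add: vec_eq_iff matrix_matrix_mult_def sum_distrib_left mult.assoc)

lemma smat_mult_right [simp]: "A ** smat c B = smat c (A ** B)"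
  by (simp add: vec_eq_iff matrix_matrix_mult_def sum_distrib_left mult_ac)

lemma mat_mult_left: "mat c ** A = smat c A"
  by (simp add: vec_eq_iff matrix_matrix_mult_def mat_def if_distrib[of "\<lambda>x. x * _"] cong: if_cong)

lemma mat_mult_right: "A ** mat c = smat c A"
  by (simp add: vec_eq_iff matrix_matrix_mult_def mat_def if_distrib[of "\<lambda>x. _ * x"] mult.commute cong: if_cong)

lemma matrix_add_rdistrib: "(A + B) ** C = A ** C + B ** (C :: 'a::semiring_1 ^ 'n ^ 'm)"
  by (simp add: vec_eq_iff matrix_matrix_mult_def distrib_right sum.distrib)

definition form :: "complex ^ 'n ^ 'n \<Rightarrow> complex ^ 'n \<Rightarrow> complex ^ 'n \<Rightarrow> complex" where
  "form C f v = (\<Sum>i\<in>UNIV. \<Sum>j\<in>UNIV. f $ i * C $ i $ j * v $ j)"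

text \<open>The middle part f X v' is a scalar. This collapses a product of rank one matrices
  interspersed with constants to one rank one matrix times a product of such scalars.\<close>

lemma outer_mult_outer: "outer v f ** X ** outer v' f' = smat (form X f v') (outer v f')"
proof -
  have "(\<Sum>k\<in>UNIV. (\<Sum>l\<in>UNIV. v $ i * f $ l * X $ l $ k) * (v' $ k * f' $ j)) =
      (\<Sum>l\<in>UNIV. \<Sum>k\<in>UNIV. f $ l * X $ l $ k * v' $ k) * (v $ i * f' $ j)" for i j
    unfolding sum_distrib_right by (subst sum.swap) (intro sum.cong refl, simp add: mult_ac)
  then show ?thesis by (simp add: vec_eq_iff matrix_matrix_mult_def form_def)
qed

lemma form_mat_1: "form (mat 1) f v = (\<Sum>i\<in>UNIV. f $ i * v $ i)"
  unfolding form_def mat_def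
  by (intro sum.cong refl) (simp add: if_distrib[of "\<lambda>x. _ * x"] if_distrib[of "\<lambda>x. x * _"] cong: if_cong)

lemma transvection_mult:
  assumes "form (mat 1) f v = 0"
  shows "transvection s v f ** transvection t v f = transvection (s + t) v f"
proof -
  have "outer v f ** outer v f = smat 0 (outer v f)"
    using outer_mult_outer[of v f "mat 1" v f] assms by (simp add: matrix_mul_rid)
  then show ?thesis
    unfolding transvection_def
    by (simp add: matrix_add_ldistrib matrix_add_rdistrib matrix_mul_rid matrix_mul_lid)
      (simp add: vec_eq_iff algebra_simps)
qed

lemma transvection_0 [simp]: "transvection 0 v f = mat 1"
  by (simp add: transvection_def vec_eq_iff)

text \<open>The determinant is a polynomial in the parameter with a polynomial inverse, hence constant.\<close>

lemma det_transvection: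
  fixes v f :: "complex ^ 'n"
  assumes "form (mat 1) f v = 0"
  shows "det (transvection t v f) = 1"
proof -
  have "(\<lambda>A :: complex ^ 'n ^ 'n. det A) \<in> alg_gen matrix_entries"
    by (intro alg_gen_det entry_in_alg_gen)
  then have "\<exists>P. \<forall>z. det (transvection z v f) = poly P z"
  proof (rule alg_gen_along_curve)
    fix b :: "complex ^ 'n ^ 'n \<Rightarrow> complex" assume "b \<in> matrix_entries"
    then obtain i j where "b = (\<lambda>A. A $ i $ j)" unfolding matrix_entries_def by blast
    then have "b (transvection z v f) = poly [:mat 1 $ i $ j, v $ i * f $ j:] z" for z
      by (simp add: transvection_def)
    then show "\<exists>P. \<forall>z. b (transvection z v f) = poly P z" by blast
  qed
  then obtain P where P: "\<And>z. det (transvection z v f) = poly P z" by blast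
  have "det (transvection z v f) * det (transvection (- z) v f) = 1" for z
    unfolding det_mul[symmetric] transvection_mult[OF assms] by simp
  then have "poly (P * (P \<circ>\<^sub>p [:0, -1:])) z = poly 1 z" for z
    unfolding P by (simp add: poly_pcompose)
  then have 1: "P * (P \<circ>\<^sub>p [:0, -1:]) = 1" by (intro poly_ext) simp
  then have "P \<noteq> 0" "P \<circ>\<^sub>p [:0, -1:] \<noteq> 0" by auto
  then have "degree P = 0" using degree_mult_eq[of P "P \<circ>\<^sub>p [:0, -1:]"] 1 by simp
  then obtain c where "P = [:c:]" by (auto elim: degree_eq_zeroE)
  moreover have "poly P 0 = 1" using P[of 0] by simp
  ultimately show ?thesis unfolding P by simp
qed

subsection \<open>Functions with algebraically independent leading terms\<close>

lemma alg_indep_0: "T \<noteq> {} \<Longrightarrow> alg_indep 0 f T"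
  by (auto intro!: alg_indepI simp: exponents_def)

text \<open>Let \<open>D\<close> be the largest total degree in a relation. Divided by the
  \<open>D\<close>-th power of \<open>n ^ d\<close>, the relation tends to its homogeneous part of
  degree \<open>D\<close> at \<open>\<kappa> s\<close> times (1, s 1, s 2, ...). The power of
  \<open>\<kappa>\<close> cancels because it is a nonzero polynomial, and homogeneity extends the
  vanishing to all points. Coordinate 0 is the growing parameter, hence the 1 in its place.\<close>

lemma alg_indep_leading:
  fixes G :: "nat \<Rightarrow> (nat \<Rightarrow> complex) \<Rightarrow> complex"
  assumes "k > 0" "d > 0" and \<kappa>: "\<kappa> \<in> polyn m" "\<kappa> s1 \<noteq> 0"
    and lim: "\<And>s j. j < k \<Longrightarrow> (\<lambda>n. G j (s(0 := of_nat n)) / of_nat n ^ d)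
      \<longlonglongrightarrow> \<kappa> s * (if j = 0 then 1 else s j)"
  shows "alg_indep k G UNIV"
proof (rule alg_indepI, rule ccontr)
  fix N c e0
  assume rel: "\<And>s. s \<in> UNIV \<Longrightarrow> (\<Sum>e\<in>exponents k N. c e * (\<Prod>j<k. G j s ^ e j)) = 0"
    and e0: "e0 \<in> exponents k N" "c e0 \<noteq> 0"
  define deg where "deg e = (\<Sum>j<k. e j)" for e :: "nat \<Rightarrow> nat"
  define D where "D = Max (deg ` {e \<in> exponents k N. c e \<noteq> 0})"
  have D: "deg e \<le> D" if "e \<in> exponents k N" "c e \<noteq> 0" for e
    unfolding D_def using that by (intro Max_ge) auto
  have "D \<in> deg ` {e \<in> exponents k N. c e \<noteq> 0}"
    unfolding D_def using e0 by (intro Max_in) auto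
  then obtain e1 where e1: "e1 \<in> exponents k N" "c e1 \<noteq> 0" "deg e1 = D" by auto
  define c' where "c' e = (if deg e = D then c e else 0)" for e
  let ?x = "\<lambda>s j. if j = 0 then 1 else s j :: complex"
  let ?R = "\<lambda>x. \<Sum>e\<in>exponents k N. c' e * (\<Prod>j<k. x j ^ e j)"
  have lead: "\<kappa> s ^ D * ?R (?x s) = 0" for s
  proof -
    let ?g = "\<lambda>n j. G j (s(0 := of_nat n)) / of_nat n ^ d"
    \<comment> \<open>The rescaled relation: a term of degree below \<open>D\<close> keeps a
      positive power of \<open>1 / n ^ d\<close> and disappears in the limit.\<close>
    let ?S = "\<lambda>n. \<Sum>e\<in>exponents k N. c e * (\<Prod>j<k. ?g n j ^ e j) * (1 / of_nat n ^ d) ^ (D - deg e)"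
    have zero: "?S n = 0" if "n > 0" for n :: nat
    proof -
      have "c e * (\<Prod>j<k. ?g n j ^ e j) * (1 / of_nat n ^ d) ^ (D - deg e) =
          (1 / of_nat n ^ d) ^ D * (c e * (\<Prod>j<k. G j (s(0 := of_nat n)) ^ e j))"
        if "e \<in> exponents k N" for e
      proof (cases "c e = 0")
        case False
        have "(\<Prod>j<k. ?g n j ^ e j) =
            (\<Prod>j<k. G j (s(0 := of_nat n)) ^ e j) * (1 / of_nat n ^ d) ^ deg e"
          unfolding deg_def power_sum prod.distrib[symmetric]
          by (intro prod.cong refl) (simp add: power_divide)
        moreover have "(1 / of_nat n ^ d :: complex) ^ deg e * (1 / of_nat n ^ d) ^ (D - deg e) =
            (1 / of_nat n ^ d) ^ D"
          using D[OF that False] by (simp flip: power_add)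
        ultimately show ?thesis by (simp add: mult_ac)
      qed simp
      then have "?S n = (1 / of_nat n ^ d) ^ D *
          (\<Sum>e\<in>exponents k N. c e * (\<Prod>j<k. G j (s(0 := of_nat n)) ^ e j))"
        unfolding sum_distrib_left by (intro sum.cong refl)
      then show ?thesis using rel by simp
    qed
    have inv: "(\<lambda>n. 1 / of_nat n ^ d :: complex) \<longlonglongrightarrow> 0"
    proof -
      have "(\<lambda>n. (1 / of_nat n) ^ d :: complex) \<longlonglongrightarrow> 0 ^ d"
        by (intro tendsto_power lim_1_over_n)
      then show ?thesis using \<open>d > 0\<close> by (simp add: power_divide zero_power)
    qed
    have "?S \<longlonglongrightarrow> (\<Sum>e\<in>exponents k N. c e * (\<Prod>j<k. (\<kappa> s * ?x s j) ^ e j) * 0 ^ (D - deg e))"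
      by (intro tendsto_sum tendsto_mult tendsto_const tendsto_prod tendsto_power lim inv) auto
    moreover have "eventually (\<lambda>n. ?S n = 0) sequentially"
      using zero by (intro eventually_sequentiallyI[of 1]) simp
    then have "?S \<longlonglongrightarrow> 0" by (rule tendsto_eventually)
    ultimately have "(\<Sum>e\<in>exponents k N. c e * (\<Prod>j<k. (\<kappa> s * ?x s j) ^ e j) * 0 ^ (D - deg e)) = 0"
      using LIMSEQ_unique by blast
    \<comment> \<open>The power of 0 is 1 if \<open>deg e\<close> is at least \<open>D\<close>, by
      truncated subtraction; beyond \<open>D\<close> the coefficient is zero.\<close>
    moreover have "c e * (\<Prod>j<k. (\<kappa> s * ?x s j) ^ e j) * 0 ^ (D - deg e) =
        \<kappa> s ^ D * (c' e * (\<Prod>j<k. ?x s j ^ e j))" if "e \<in> exponents k N" for e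
    proof (cases "c e \<noteq> 0 \<and> deg e = D")
      case True
      have "(\<Prod>j<k. (\<kappa> s * ?x s j) ^ e j) = \<kappa> s ^ deg e * (\<Prod>j<k. ?x s j ^ e j)"
        unfolding deg_def power_sum prod.distrib[symmetric] by (simp add: power_mult_distrib)
      then show ?thesis using True by (simp add: c'_def)
    next
      case False
      then show ?thesis using D[OF that] by (cases "c e = 0") (auto simp: c'_def)
    qed
    ultimately show ?thesis by (simp add: sum_distrib_left)
  qed
  have R0: "?R (?x s) = 0" for s
  proof -
    have var: "(\<lambda>s. s j) \<in> polyn (max m k)" if "j < k" for j
      using that unfolding polyn_def by (intro alg_gen.gen) auto
    have "(\<lambda>s. \<kappa> s ^ D) \<in> polyn (max m k)"
      using \<kappa>(1) unfolding polyn_def by (intro alg_gen_power) (auto elim!: alg_gen_mono)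
    moreover have "(\<lambda>s. if j = 0 then 1 else s j) \<in> polyn (max m k)" if "j < k" for j
      using var[OF that] by (cases "j = 0") (auto simp: polyn_def alg_gen.const)
    then have "(\<lambda>s. ?R (?x s)) \<in> polyn (max m k)"
      unfolding polyn_def
      by (intro alg_gen_sum alg_gen.mult alg_gen.const alg_gen_prod alg_gen_power) auto
    ultimately show ?thesis
      using integral_onD[OF integral_on_polyn, of "\<lambda>s. \<kappa> s ^ D" "max m k" "\<lambda>s. ?R (?x s)"] lead \<kappa>(2)
      by auto
  qed
  \<comment> \<open>Dehomogenising requires \<open>s 0\<close> to be nonzero; the factor
    \<open>s 0\<close> covers the other points and is cancelled afterwards.\<close>
  have homog: "s 0 * ?R s = 0" for s
  proof (cases "s 0 = 0")
    case False
    have "?R s = s 0 ^ D * ?R (?x (\<lambda>j. s j / s 0))"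
      unfolding sum_distrib_left
    proof (intro sum.cong refl)
      fix e
      have "(\<Prod>j<k. s j ^ e j) = s 0 ^ deg e * (\<Prod>j<k. ?x (\<lambda>j. s j / s 0) j ^ e j)"
        unfolding deg_def power_sum prod.distrib[symmetric]
        using False by (intro prod.cong refl) (auto simp: power_divide)
      then show "c' e * (\<Prod>j<k. s j ^ e j) = s 0 ^ D * (c' e * (\<Prod>j<k. ?x (\<lambda>j. s j / s 0) j ^ e j))"
        by (simp add: c'_def)
    qed
    then show ?thesis using R0 by simp
  qed simp
  have "?R s = 0" for s
  proof -
    have "(\<lambda>s. s j) \<in> polyn k" if "j < k" for j
      using that unfolding polyn_def by (intro alg_gen.gen) auto
    then have "(\<lambda>s. s 0) \<in> polyn k" "?R \<in> polyn k"
      using \<open>k > 0\<close> unfolding polyn_def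
      by (auto intro!: alg_gen_sum alg_gen.mult alg_gen.const alg_gen_prod alg_gen_power)
    then have "(\<forall>s :: nat \<Rightarrow> complex. s 0 = 0) \<or> (\<forall>s. ?R s = 0)"
      using integral_onD[OF integral_on_polyn, of "\<lambda>s. s 0" k ?R] homog by simp
    moreover have "\<not> (\<forall>s :: nat \<Rightarrow> complex. s 0 = 0)"
      by (auto intro!: exI[of _ "\<lambda>_. 1"])
    ultimately show ?thesis by blast
  qed
  then have "c' e1 = 0" by (intro alg_indepD[where c = c', OF alg_indep_coordinates _ e1(1)])
  then show False using e1 by (simp add: c'_def)
qed

subsection \<open>A chart of the rank one nilpotent matrices\<close>

text \<open>Positions that serve as coordinates. With v and f normalised to 1 at \<open>a\<close>
  and \<open>b\<close>, the entries of v f in row \<open>a\<close> are those of f and the entries in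
  column \<open>b\<close> are those of v. Position (a, a) is left out since f v = 0 determines it;
  position (a, b) carries the scale, which \<open>\<tau>0\<close> makes parameter 0.\<close>

definition chart_entries :: "'n \<Rightarrow> 'n \<Rightarrow> ('n \<times> 'n) set" where
  "chart_entries a b = {a} \<times> (- {a}) \<union> (- {a}) \<times> {b}"

lemma card_chart_entries: "card (chart_entries a (b :: 'n::finite)) = 2 * (CARD('n) - 1)"
proof -
  have "card (chart_entries a b) = card ({a} \<times> (- {a})) + card ((- {a}) \<times> {b})"
    unfolding chart_entries_def by (intro card_Un_disjoint) auto
  then show ?thesis by (simp add: card_cartesian_product Compl_eq_Diff_UNIV)
qed

locale nilpotent_chart =
  fixes a b :: "'n::finite" and \<tau> :: "'n \<times> 'n \<Rightarrow> nat"
  assumes ab: "a \<noteq> b" and \<tau>: "bij_betw \<tau> (chart_entries a b) {..<2 * (CARD('n) - 1)}"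
    and \<tau>0: "\<tau> (a, b) = 0"
begin

definition colv :: "(nat \<Rightarrow> complex) \<Rightarrow> complex ^ 'n" where
  "colv s = (\<chi> p. if p = a then 1 else s (\<tau> (p, b)))"

text \<open>The value at \<open>a\<close> is the solution of f v = 0 for that coordinate, where v is
  1.\<close>

definition rowf :: "(nat \<Rightarrow> complex) \<Rightarrow> complex ^ 'n" where
  "rowf s = (\<chi> q. if q = b then 1 else if q = a
     then - (\<Sum>q\<in>-{a}. (if q = b then 1 else s (\<tau> (a, q))) * s (\<tau> (q, b)))
     else s (\<tau> (a, q)))"

abbreviation nilp :: "(nat \<Rightarrow> complex) \<Rightarrow> complex ^ 'n ^ 'n" where
  "nilp s \<equiv> outer (colv s) (rowf s)"

lemma nparams_pos: "2 * (CARD('n) - 1) > 0"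
proof -
  have "(a, b) \<in> chart_entries a b" using ab by (simp add: chart_entries_def)
  then have "\<tau> (a, b) \<in> {..<2 * (CARD('n) - 1)}" using \<tau> by (auto simp: bij_betw_def)
  then show ?thesis by auto
qed

lemma \<tau>_less: "x \<in> chart_entries a b \<Longrightarrow> \<tau> x < 2 * (CARD('n) - 1)"
  using \<tau> by (auto simp: bij_betw_def)

lemma \<tau>_eq_0: "x \<in> chart_entries a b \<Longrightarrow> \<tau> x = 0 \<longleftrightarrow> x = (a, b)"
  using inj_on_eq_iff[OF bij_betw_imp_inj_on[OF \<tau>], of x "(a, b)"] \<tau>0 ab
  by (auto simp: chart_entries_def)

lemma form_rowf_colv: "form (mat 1) (rowf s) (colv s) = 0"
proof -
  have "(\<Sum>i\<in>UNIV. rowf s $ i * colv s $ i) = rowf s $ a * colv s $ a + (\<Sum>i\<in>-{a}. rowf s $ i * colv s $ i)"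
    by (subst sum.remove[of UNIV a]) (auto simp: Compl_eq_Diff_UNIV)
  also have "(\<Sum>i\<in>-{a}. rowf s $ i * colv s $ i) =
      (\<Sum>q\<in>-{a}. (if q = b then 1 else s (\<tau> (a, q))) * s (\<tau> (q, b)))"
    by (intro sum.cong refl) (auto simp: rowf_def colv_def)
  finally show ?thesis unfolding form_mat_1 using ab by (simp add: rowf_def colv_def)
qed

lemma upd_0_colv: "p \<noteq> a \<Longrightarrow> (s(0 := t)) (\<tau> (p, b)) = s (\<tau> (p, b))"
  using \<tau>_eq_0[of "(p, b)"] by (auto simp: chart_entries_def)

lemma upd_0_rowf: "q \<noteq> a \<Longrightarrow> q \<noteq> b \<Longrightarrow> (s(0 := t)) (\<tau> (a, q)) = s (\<tau> (a, q))"
  using \<tau>_eq_0[of "(a, q)"] by (auto simp: chart_entries_def)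

lemma colv_upd_0 [simp]: "colv (s(0 := t)) = colv s"
  by (simp add: colv_def vec_eq_iff upd_0_colv del: fun_upd_apply)

lemma rowf_upd_0 [simp]: "rowf (s(0 := t)) = rowf s"
proof -
  have "(\<Sum>q\<in>-{a}. (if q = b then 1 else (s(0 := t)) (\<tau> (a, q))) * (s(0 := t)) (\<tau> (q, b))) =
      (\<Sum>q\<in>-{a}. (if q = b then 1 else s (\<tau> (a, q))) * s (\<tau> (q, b)))"
    by (intro sum.cong refl) (simp add: upd_0_colv upd_0_rowf del: fun_upd_apply)
  then show ?thesis unfolding rowf_def by (simp add: vec_eq_iff upd_0_rowf del: fun_upd_apply)
qed

lemma var_polyn: "x \<in> chart_entries a b \<Longrightarrow> (\<lambda>s. s (\<tau> x)) \<in> polyn (2 * (CARD('n) - 1))"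
  unfolding polyn_def using \<tau>_less by (intro alg_gen.gen) blast

lemma colv_polyn: "(\<lambda>s. colv s $ p) \<in> polyn (2 * (CARD('n) - 1))"
proof (cases "p = a")
  case False
  then show ?thesis using var_polyn[of "(p, b)"] by (simp add: colv_def chart_entries_def)
qed (simp add: colv_def polyn_def alg_gen.const)

lemma rowf_polyn: "(\<lambda>s. rowf s $ q) \<in> polyn (2 * (CARD('n) - 1))"
proof -
  have 1: "(\<lambda>s. if q = b then 1 else s (\<tau> (a, q))) \<in> polyn (2 * (CARD('n) - 1))" if "q \<noteq> a" for q
    using var_polyn[of "(a, q)"] that
    by (cases "q = b") (auto simp: chart_entries_def polyn_def alg_gen.const)
  have 2: "(\<lambda>s. s (\<tau> (q, b))) \<in> polyn (2 * (CARD('n) - 1))" if "q \<noteq> a" for q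
    using var_polyn[of "(q, b)"] that by (simp add: chart_entries_def)
  show ?thesis
  proof (cases "q = a")
    case True
    have "(\<lambda>s. - (\<Sum>q\<in>-{a}. (if q = b then 1 else s (\<tau> (a, q))) * s (\<tau> (q, b)))) \<in> polyn (2 * (CARD('n) - 1))"
      using 1 2 unfolding polyn_def by (intro alg_gen_uminus alg_gen_sum alg_gen.mult) auto
    then show ?thesis using True ab by (simp add: rowf_def)
  next
    case False
    then show ?thesis using 1[OF False] by (cases "q = b") (simp_all add: rowf_def)
  qed
qed

lemma form_polyn: "(\<lambda>s. form C (rowf s) (colv s)) \<in> polyn (2 * (CARD('n) - 1))"
  using rowf_polyn colv_polyn unfolding form_def polyn_def
  by (intro alg_gen_sum alg_gen.mult alg_gen.const)

text \<open>Entry (a, b) is 1 and the other chart entries are the parameters themselves, which is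
  the shape of the limit required by \<open>alg_indep_leading\<close>.\<close>

lemma nilp_entries:
  assumes "x \<in> chart_entries a b"
  shows "nilp s $ fst x $ snd x = (if \<tau> x = 0 then 1 else s (\<tau> x))"
  using assms \<tau>_eq_0[OF assms] ab by (auto simp: chart_entries_def colv_def rowf_def)

lemma exists_chart_point:
  obtains s where "s 0 = t" "\<And>p. p \<noteq> a \<Longrightarrow> colv s $ p = x p"
    "\<And>q. q \<noteq> a \<Longrightarrow> q \<noteq> b \<Longrightarrow> rowf s $ q = y q"
proof
  let ?\<sigma> = "inv_into (chart_entries a b) \<tau>"
  let ?s = "\<lambda>k. case ?\<sigma> k of (p, q) \<Rightarrow> if (p, q) = (a, b) then t else if p = a then y q else x p"
  have \<sigma>: "?\<sigma> (\<tau> z) = z" if "z \<in> chart_entries a b" for z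
    using \<tau> that by (auto simp: bij_betw_def)
  have "?\<sigma> 0 = (a, b)" using \<sigma>[of "(a, b)"] \<tau>0 ab by (simp add: chart_entries_def)
  then show "?s 0 = t" by simp
  show "colv ?s $ p = x p" if "p \<noteq> a" for p
    using \<sigma>[of "(p, b)"] that by (auto simp: chart_entries_def colv_def)
  show "rowf ?s $ q = y q" if "q \<noteq> a" "q \<noteq> b" for q
    using \<sigma>[of "(a, q)"] that by (auto simp: chart_entries_def rowf_def)
qed

text \<open>Dividing v by its entry at \<open>a\<close> and f by its entry at \<open>b\<close> moves
  the scale into parameter 0; the remaining coordinate of f is forced by f v = 0 on both
  sides.\<close>

lemma chart_point_eq:
  assumes fv: "form (mat 1) f v = 0" and nz: "v $ a \<noteq> 0" "f $ b \<noteq> 0"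
  obtains s where "s 0 = v $ a * f $ b" "outer v f = smat (s 0) (nilp s)"
proof -
  obtain s where s: "s 0 = v $ a * f $ b" "\<And>p. p \<noteq> a \<Longrightarrow> colv s $ p = v $ p / v $ a"
    "\<And>q. q \<noteq> a \<Longrightarrow> q \<noteq> b \<Longrightarrow> rowf s $ q = f $ q / f $ b"
    using exists_chart_point[of "v $ a * f $ b" "\<lambda>p. v $ p / v $ a" "\<lambda>q. f $ q / f $ b"] by metis
  have v: "v $ p = v $ a * colv s $ p" for p
    using s(2)[of p] nz by (cases "p = a") (simp_all add: colv_def)
  have f': "f $ q = f $ b * rowf s $ q" if "q \<noteq> a" for q
    using s(3)[of q] nz that by (cases "q = b") (simp_all add: rowf_def)
  have remove: "(\<Sum>i\<in>UNIV. g i) = g a + (\<Sum>i\<in>-{a}. g i)" for g :: "'n \<Rightarrow> complex"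
    by (subst sum.remove[of UNIV a]) (auto simp: Compl_eq_Diff_UNIV)
  have "(\<Sum>i\<in>-{a}. f $ i * v $ i) = f $ b * v $ a * (\<Sum>i\<in>-{a}. rowf s $ i * colv s $ i)"
    unfolding sum_distrib_left
  proof (intro sum.cong refl)
    fix i assume "i \<in> - {a}"
    then show "f $ i * v $ i = f $ b * v $ a * (rowf s $ i * colv s $ i)"
      using f'[of i] v[of i] by simp
  qed
  moreover have "f $ a * v $ a + (\<Sum>i\<in>-{a}. f $ i * v $ i) = 0"
    using fv unfolding form_mat_1 remove .
  moreover have "rowf s $ a * colv s $ a + (\<Sum>i\<in>-{a}. rowf s $ i * colv s $ i) = 0"
    using form_rowf_colv[of s] unfolding form_mat_1 remove .
  then have "(\<Sum>i\<in>-{a}. rowf s $ i * colv s $ i) = - rowf s $ a"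
    by (simp add: colv_def add_eq_0_iff)
  ultimately have "v $ a * (f $ a - f $ b * rowf s $ a) = 0" by (simp add: algebra_simps)
  then have "f $ a = f $ b * rowf s $ a" using nz by simp
  then have f: "f $ q = f $ b * rowf s $ q" for q using f' by (cases "q = a") auto
  have "outer v f = smat (s 0) (nilp s)"
    unfolding vec_eq_iff outer_nth smat_nth s(1) using v f by (metis mult.assoc mult.left_commute)
  then show thesis using that s(1) by blast
qed

text \<open>If the form vanishes on the chart, every vector with nonzero \<open>a\<close>-coordinate is an
  eigenvector; comparing \<open>e\<^sub>a\<close>, \<open>e\<^sub>a + e\<^sub>p\<close> and \<open>e\<^sub>a + 2 e\<^sub>p\<close> shows that all eigenvalues agree.\<close>

lemma form_nonzero:
  assumes "\<And>c. C \<noteq> mat c"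
  shows "\<exists>s. form C (rowf s) (colv s) \<noteq> 0"
proof (rule ccontr)
  assume "\<not> ?thesis"
  then have zero: "form C (rowf s) (colv s) = 0" for s by simp
  have eig: "(C *v v) $ q = v $ q * (C *v v) $ a" if v: "v $ a = 1" for v q
  proof -
    let ?w = "C *v v"
    \<comment> \<open>Here v is fixed and f is arbitrary off \<open>a\<close> apart from being 1 at
      \<open>b\<close>. Eliminating the coordinate of f at \<open>a\<close> by f v = 0 turns f C v =
      0 into this condition, from which special choices of \<open>y\<close> isolate the
      coordinates.\<close>
    have lin: "(\<Sum>i\<in>-{a}. y i * (?w $ i - v $ i * ?w $ a)) = 0" if "y b = 1" for y
    proof -
      obtain s where s: "\<And>p. p \<noteq> a \<Longrightarrow> colv s $ p = v $ p"
        "\<And>q. q \<noteq> a \<Longrightarrow> q \<noteq> b \<Longrightarrow> rowf s $ q = y q"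
        using exists_chart_point[of 0 "\<lambda>p. v $ p" y] by metis
      have cv: "colv s = v"
        unfolding vec_eq_iff
      proof
        fix p show "colv s $ p = v $ p" using s(1)[of p] v by (cases "p = a") (simp_all add: colv_def)
      qed
      have ry: "rowf s $ q = y q" if "q \<noteq> a" for q
        using s(2)[OF that] \<open>y b = 1\<close> by (cases "q = b") (auto simp: rowf_def)
      have remove: "(\<Sum>i\<in>UNIV. g i) = g a + (\<Sum>i\<in>-{a}. g i)" for g :: "'n \<Rightarrow> complex"
        by (subst sum.remove[of UNIV a]) (auto simp: Compl_eq_Diff_UNIV)
      have "(\<Sum>i\<in>UNIV. rowf s $ i * ?w $ i) = 0"
        using zero[of s] unfolding form_def cv matrix_vector_mult_def
        by (simp add: sum_distrib_left mult.assoc)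
      then have 1: "rowf s $ a * ?w $ a + (\<Sum>i\<in>-{a}. y i * ?w $ i) = 0"
        unfolding remove using ry by simp
      have "rowf s $ a * v $ a + (\<Sum>i\<in>-{a}. y i * v $ i) = 0"
        using form_rowf_colv[of s] unfolding form_mat_1 cv remove using ry by simp
      then have "rowf s $ a = - (\<Sum>i\<in>-{a}. y i * v $ i)" using v by (simp add: add_eq_0_iff)
      with 1 show ?thesis
        by (simp add: right_diff_distrib sum_subtractf sum_distrib_right mult.assoc)
    qed
    have b0: "?w $ b - v $ b * ?w $ a = 0"
    proof -
      have "(\<Sum>i\<in>-{a}. (if i = b then 1 else 0) * (?w $ i - v $ i * ?w $ a)) = 0"
        by (rule lin) simp
      then show ?thesis using ab by (simp add: if_distrib[of "\<lambda>x. x * _"] cong: if_cong)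
    qed
    show ?thesis
    proof (cases "q = a \<or> q = b")
      case True
      then show ?thesis using v b0 by auto
    next
      case False
      have "(\<Sum>i\<in>-{a}. ((if i = b then 1 else 0) + (if i = q then 1 else 0)) * (?w $ i - v $ i * ?w $ a)) = 0"
        by (rule lin) (use False in auto)
      then have "(\<Sum>i\<in>-{a}. (if i = b then 1 else 0) * (?w $ i - v $ i * ?w $ a)) +
          (\<Sum>i\<in>-{a}. (if i = q then 1 else 0) * (?w $ i - v $ i * ?w $ a)) = 0"
        by (simp only: distrib_right sum.distrib)
      then show ?thesis using ab False b0 by (simp add: if_distrib[of "\<lambda>x. x * _"] cong: if_cong)
    qed
  qed
  define l where "l = C $ a $ a"
  have Cax: "C *v axis p 1 = column p C" for p
    by (simp add: vec_eq_iff matrix_vector_mult_def column_def axis_def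
        if_distrib[of "\<lambda>x. _ * x"] cong: if_cong)
  have a1: "C $ q $ a = axis a 1 $ q * l" for q
    using eig[of "axis a 1" q, unfolded Cax] by (simp add: column_def l_def axis_def)
  have "C $ q $ p = (if q = p then l else 0)" if p: "p \<noteq> a" for p q
  proof -
    have e: "C $ q $ a + z * C $ q $ p = (axis a 1 $ q + z * axis p 1 $ q) * (l + z * C $ a $ p)" for z q
    proof -
      have "C *v (axis a 1 + z *s axis p 1) = column a C + z *s column p C"
        by (simp add: matrix_vector_right_distrib vector_scalar_commute Cax)
      then show ?thesis
        using eig[of "axis a 1 + z *s axis p 1" q] p by (simp add: column_def l_def axis_def)
    qed
    have "C $ a $ p = 0"
      using e[of p 1] e[of p 2] a1[of p] p by (simp add: axis_def algebra_simps)
    then show ?thesis using e[of q 1] a1[of q] p by (auto simp: axis_def algebra_simps)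
  qed
  moreover have "C $ q $ p = (if q = p then l else 0)" if "p = a" for p q
    using a1[of q] that by (simp add: axis_def)
  ultimately have "C $ q $ p = (if q = p then l else 0)" for p q by (cases "p = a") auto
  then have "C = mat l" by (simp add: vec_eq_iff mat_def)
  with assms show False by blast
qed

end

lemma exists_nilpotent_chart:
  assumes "CARD('n) \<ge> 2"
  obtains a b :: "'n::finite" and \<tau> where "nilpotent_chart a b \<tau>"
proof -
  have "\<not> is_singleton (UNIV :: 'n set)" using assms by (simp add: is_singleton_altdef)
  then obtain a b :: 'n where ab: "a \<noteq> b" by (auto simp: is_singleton_def)
      (metis UNIV_I UNIV_eq_I insert_iff)
  let ?Q = "chart_entries a b"
  have "(a, b) \<in> ?Q" using ab by (simp add: chart_entries_def)
  obtain h where h: "bij_betw h ?Q {..<card ?Q}"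
    using ex_bij_betw_finite_nat[of ?Q] by (auto simp: atLeast0LessThan)
  \<comment> \<open>The transposition gives the position (a, b) the number 0.\<close>
  define \<tau> where "\<tau> = Transposition.transpose (h (a, b)) 0 \<circ> h"
  have lt: "h (a, b) < card ?Q" using h \<open>(a, b) \<in> ?Q\<close> by (auto simp: bij_betw_def)
  then have "bij_betw (Transposition.transpose (h (a, b)) 0) {..<card ?Q} {..<card ?Q}"
    by (intro bij_betw_imageI) auto
  then have "bij_betw \<tau> ?Q {..<card ?Q}" unfolding \<tau>_def using h by (rule bij_betw_trans[rotated])
  then have "nilpotent_chart a b \<tau>"
    using ab unfolding card_chart_entries by unfold_locales (auto simp: \<tau>_def)
  then show thesis by (rule that)
qed

subsection \<open>Substituting products of two transvections into a word\<close>

text \<open>The coefficient of degree \<open>k\<close> in \<open>n\<close> when nothing larger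
  occurs. \<open>B\<close> may be zero, so that products need no condition excluding
  cancellation.\<close>

definition scaled_lim :: "(nat \<Rightarrow> complex ^ 'n ^ 'm) \<Rightarrow> nat \<Rightarrow> complex ^ 'n ^ 'm \<Rightarrow> bool" where
  "scaled_lim A k B \<longleftrightarrow> (\<forall>i j. (\<lambda>n. A n $ i $ j / of_nat n ^ k) \<longlonglongrightarrow> B $ i $ j)"

lemma scaled_lim_const: "scaled_lim (\<lambda>n. C) 0 C"
  by (simp add: scaled_lim_def)

lemma scaled_lim_mult:
  assumes "scaled_lim A k B" "scaled_lim A' k' B'"
  shows "scaled_lim (\<lambda>n. A n ** A' n) (k + k') (B ** B')"
  unfolding scaled_lim_def
proof (intro allI)
  fix i j
  have "(\<lambda>n. \<Sum>l\<in>UNIV. (A n $ i $ l / of_nat n ^ k) * (A' n $ l $ j / of_nat n ^ k'))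
      \<longlonglongrightarrow> (\<Sum>l\<in>UNIV. B $ i $ l * B' $ l $ j)"
    using assms unfolding scaled_lim_def by (intro tendsto_sum tendsto_mult) auto
  then show "(\<lambda>n. (A n ** A' n) $ i $ j / of_nat n ^ (k + k')) \<longlonglongrightarrow> (B ** B') $ i $ j"
    by (simp add: matrix_matrix_mult_def sum_divide_distrib power_add)
qed

lemma scaled_lim_transvection:
  "scaled_lim (\<lambda>n. transvection (c * of_nat n) v f) 1 (smat c (outer v f))"
  unfolding scaled_lim_def
proof (intro allI)
  fix i j
  have "(\<lambda>n. mat 1 $ i $ j * (1 / of_nat n) + c * (v $ i * f $ j)) \<longlonglongrightarrow>
      mat 1 $ i $ j * 0 + c * (v $ i * f $ j)"
    by (intro tendsto_intros lim_1_over_n)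
  moreover have "eventually (\<lambda>n. mat 1 $ i $ j * (1 / of_nat n) + c * (v $ i * f $ j) =
      transvection (c * of_nat n) v f $ i $ j / of_nat n ^ 1) sequentially"
    by (rule eventually_sequentiallyI[of 1]) (simp add: transvection_def field_simps)
  ultimately have "(\<lambda>n. transvection (c * of_nat n) v f $ i $ j / of_nat n ^ 1)
      \<longlonglongrightarrow> mat 1 $ i $ j * 0 + c * (v $ i * f $ j)"
    by (rule Lim_transform_eventually)
  then show "(\<lambda>n. transvection (c * of_nat n) v f $ i $ j / of_nat n ^ 1)
      \<longlonglongrightarrow> smat c (outer v f) $ i $ j"
    by simp
qed

lemma polyn_mult_nonzero:
  assumes "p \<in> polyn m" "q \<in> polyn m" "\<exists>s. p s \<noteq> 0" "\<exists>s. q s \<noteq> 0"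
  shows "\<exists>s. p s * q s \<noteq> 0"
  using integral_onD[OF integral_on_polyn assms(1,2)] assms(3,4) by blast

lemma invertible_SL: "A \<in> SL K \<Longrightarrow> invertible A"
  by (simp add: SL_def invertible_det_nz)

section \<open>The substitution, its leading coefficient and the lower bound for word images\<close>

context nilpotent_chart
begin

text \<open>A one-parameter group of fixed transvections, which supplies the conjugators.\<close>

definition shear :: "complex \<Rightarrow> complex ^ 'n ^ 'n" where
  "shear k = transvection k (axis a 1) (axis b 1)"

lemma form_axis: "form (mat 1) (axis b 1) (axis a 1) = 0"
  unfolding form_mat_1 using ab by (auto simp: axis_def intro!: sum.neutral)

lemma shear_mult: "shear k ** shear l = shear (k + l)"
  unfolding shear_def by (rule transvection_mult[OF form_axis])

lemma shear_mult_assoc: "shear k ** (shear l ** X) = shear (k + l) ** X"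
  by (simp add: matrix_mul_assoc shear_mult)

lemma shear_0 [simp]: "shear 0 = mat 1"
  by (simp add: shear_def)

lemma det_shear: "det (shear k) = 1"
  unfolding shear_def by (rule det_transvection[OF form_axis])

lemma invertible_shear: "invertible (shear k)"
  by (simp add: invertible_det_nz det_shear)

lemma shear_entries: "shear k $ a $ a = 1" "shear k $ a $ b = k"
  using ab by (simp_all add: shear_def transvection_def axis_def mat_def)

lemma shear_neq_mat: "k \<noteq> 0 \<Longrightarrow> shear k \<noteq> mat z"
  using shear_entries(2)[of k] ab by (auto simp: mat_def)

abbreviation transv :: "complex \<Rightarrow> (nat \<Rightarrow> complex) \<Rightarrow> complex ^ 'n ^ 'n" where
  "transv t s \<equiv> transvection t (colv s) (rowf s)"

lemma transv_mult_assoc: "transv t s ** (transv u s ** X) = transv (t + u) s ** X"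
  by (simp add: matrix_mul_assoc transvection_mult[OF form_rowf_colv])

text \<open>Conjugates by \<open>shear (h (i, \<not> \<epsilon>))\<close> and by
  \<open>shear (h (i, \<epsilon>))\<close>, with the two adjacent shears in the middle merged.
  Inversion reverses the order and negates the parameter, which is the same formula with \<epsilon>
  negated.\<close>

definition letter_subst :: "(nat \<times> bool \<Rightarrow> complex) \<Rightarrow> (nat \<Rightarrow> complex) \<Rightarrow> nat \<Rightarrow> bool \<Rightarrow> complex ^ 'n ^ 'n" where
  "letter_subst h s i \<epsilon> = shear (h (i, \<not> \<epsilon>)) ** transv (if \<epsilon> then s 0 else - s 0) s **
     shear (h (i, \<epsilon>) - h (i, \<not> \<epsilon>)) ** transv (if \<epsilon> then s 0 else - s 0) s ** shear (- h (i, \<epsilon>))"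

lemma matrix_inv_letter_subst: "matrix_inv (letter_subst h s i True) = letter_subst h s i False"
  by (rule matrix_inv_unique)
    (simp add: letter_subst_def matrix_mul_assoc[symmetric] shear_mult_assoc transv_mult_assoc shear_mult)

lemma det_letter_subst: "det (letter_subst h s i \<epsilon>) = 1"
  by (simp add: letter_subst_def det_mul det_shear det_transvection[OF form_rowf_colv])

definition letter_lead :: "(nat \<times> bool \<Rightarrow> complex) \<Rightarrow> (nat \<Rightarrow> complex) \<Rightarrow> nat \<Rightarrow> bool \<Rightarrow> complex ^ 'n ^ 'n" where
  "letter_lead h s i \<epsilon> = smat (form (shear (h (i, \<epsilon>) - h (i, \<not> \<epsilon>))) (rowf s) (colv s))
     (shear (h (i, \<not> \<epsilon>)) ** nilp s ** shear (- h (i, \<epsilon>)))"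

lemma scaled_lim_letter:
  "scaled_lim (\<lambda>n. letter_subst h (s(0 := of_nat n)) i \<epsilon>) 2 (letter_lead h s i \<epsilon>)"
proof -
  define c :: complex where "c = (if \<epsilon> then 1 else -1)"
  \<comment> \<open>Each letter contains the transvection twice, so the sign coming from the
    exponent disappears in the leading coefficient.\<close>
  have c: "c * c = 1" by (simp add: c_def)
  have T: "transv (if \<epsilon> then (s(0 := of_nat n)) 0 else - (s(0 := of_nat n)) 0) (s(0 := of_nat n)) =
      transvection (c * of_nat n) (colv s) (rowf s)" for n
    by (simp add: c_def)
  let ?X = "shear (h (i, \<epsilon>) - h (i, \<not> \<epsilon>))"
  have "scaled_lim (\<lambda>n. letter_subst h (s(0 := of_nat n)) i \<epsilon>) (0 + 1 + 0 + 1 + 0)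
     (shear (h (i, \<not> \<epsilon>)) ** smat c (nilp s) ** ?X ** smat c (nilp s) ** shear (- h (i, \<epsilon>)))"
    unfolding letter_subst_def T
    by (intro scaled_lim_mult scaled_lim_const scaled_lim_transvection)
  moreover have "shear (h (i, \<not> \<epsilon>)) ** smat c (nilp s) ** ?X ** smat c (nilp s) ** shear (- h (i, \<epsilon>)) =
      shear (h (i, \<not> \<epsilon>)) ** (nilp s ** ?X ** nilp s) ** shear (- h (i, \<epsilon>))"
    using c by (simp add: matrix_mul_assoc)
  moreover have "\<dots> = letter_lead h s i \<epsilon>"
    unfolding outer_mult_outer letter_lead_def by simp
  ultimately show ?thesis by (simp add: numeral_2_eq_2)
qed

lemma scaled_lim_foldl:
  assumes "scaled_lim A k B"
  shows "scaled_lim (\<lambda>n. foldl (\<lambda>A (i, \<epsilon>, c). A ** letter_subst h (s(0 := of_nat n)) i \<epsilon> ** c) (A n) ls)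
    (k + 2 * length ls) (foldl (\<lambda>B (i, \<epsilon>, c). B ** letter_lead h s i \<epsilon> ** c) B ls)"
  using assms
proof (induction ls arbitrary: A B k)
  case (Cons x ls)
  obtain i \<epsilon> c where x: "x = (i, \<epsilon>, c)" by (cases x)
  have "scaled_lim (\<lambda>n. A n ** letter_subst h (s(0 := of_nat n)) i \<epsilon> ** c) (k + 2 + 0)
      (B ** letter_lead h s i \<epsilon> ** c)"
    by (intro scaled_lim_mult scaled_lim_const Cons.prems scaled_lim_letter)
  from Cons.IH[OF this] show ?case by (simp add: x del: fun_upd_apply)
qed simp

text \<open>Each letter contributes the form of its inner shear and each junction the form of the
  constant between two letters. All these matrices are nonscalar, so by \<open>form_nonzero\<close>
  the factors are nonzero polynomials, and so is their product. The statement is for all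
  \<open>B\<close> because the induction splits off the first letter, which enters the
  accumulator.\<close>

lemma foldl_letter_lead:
  assumes "ls \<noteq> []" and inj: "inj h"
    and inv: "\<forall>(i, \<epsilon>, c)\<in>set ls. invertible c"
    and "successively (\<lambda>(i, \<epsilon>, c) (i', \<epsilon>', c'). \<forall>z. shear (- h (i, \<epsilon>)) ** c ** shear (h (i', \<not> \<epsilon>')) \<noteq> mat z) ls"
  shows "\<exists>\<kappa>\<in>polyn (2 * (CARD('n) - 1)). \<exists>Q. invertible Q \<and> (\<exists>s. \<kappa> s \<noteq> 0) \<and>
     (\<forall>s u. \<kappa> (s(0 := u)) = \<kappa> s) \<and>
     (\<forall>(B :: complex ^ 'n ^ 'n) s. foldl (\<lambda>B (i, \<epsilon>, c). B ** letter_lead h s i \<epsilon> ** c) B ls =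
        smat (\<kappa> s) (B ** shear (h (fst (hd ls), \<not> fst (snd (hd ls)))) ** nilp s ** Q))"
  using assms
proof (induction ls rule: induct_list012)
  case (2 x)
  obtain i \<epsilon> c where x: "x = (i, \<epsilon>, c)" by (cases x)
  let ?X = "shear (h (i, \<epsilon>) - h (i, \<not> \<epsilon>))"
  have "h (i, \<epsilon>) - h (i, \<not> \<epsilon>) \<noteq> 0" using inj by (auto dest: injD)
  then have "\<exists>s. form ?X (rowf s) (colv s) \<noteq> 0" by (intro form_nonzero shear_neq_mat)
  moreover have "invertible (shear (- h (i, \<epsilon>)) ** c)"
    using 2 by (auto simp: x intro!: invertible_mult invertible_shear)
  ultimately show ?case
    by (intro bexI[of _ "\<lambda>s. form ?X (rowf s) (colv s)"] exI[of _ "shear (- h (i, \<epsilon>)) ** c"])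
      (simp_all add: form_polyn x letter_lead_def matrix_mul_assoc del: fun_upd_apply One_nat_def)
next
  case (3 x y ls)
  obtain i \<epsilon> c where x: "x = (i, \<epsilon>, c)" by (cases x)
  obtain i' \<epsilon>' c' where y: "y = (i', \<epsilon>', c')" by (cases y)
  let ?X = "shear (h (i, \<epsilon>) - h (i, \<not> \<epsilon>))"
  let ?Y = "shear (- h (i, \<epsilon>)) ** c ** shear (h (i', \<not> \<epsilon>'))"
  obtain \<kappa> Q where IH: "\<kappa> \<in> polyn (2 * (CARD('n) - 1))" "invertible Q" "\<exists>s. \<kappa> s \<noteq> 0"
    "\<And>s u. \<kappa> (s(0 := u)) = \<kappa> s"
    "\<And>(B :: complex ^ 'n ^ 'n) s. foldl (\<lambda>B (i, \<epsilon>, c). B ** letter_lead h s i \<epsilon> ** c) B (y # ls) =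
        smat (\<kappa> s) (B ** shear (h (i', \<not> \<epsilon>')) ** nilp s ** Q)"
  proof -
    have "\<forall>(i, \<epsilon>, c)\<in>set (y # ls). invertible c" using "3.prems"(3) by simp
    moreover have "successively (\<lambda>(i, \<epsilon>, c) (i', \<epsilon>', c').
        \<forall>z. shear (- h (i, \<epsilon>)) ** c ** shear (h (i', \<not> \<epsilon>')) \<noteq> mat z) (y # ls)"
      using "3.prems"(4) by simp
    ultimately show thesis
      using "3.IH"(2)[OF list.simps(3) "3.prems"(2)] that unfolding y list.sel fst_conv snd_conv by blast
  qed
  define \<kappa>' where "\<kappa>' s = form ?X (rowf s) (colv s) * form ?Y (rowf s) (colv s)" for s
  have "h (i, \<epsilon>) - h (i, \<not> \<epsilon>) \<noteq> 0" using inj by (auto dest: injD)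
  then have "\<exists>s. form ?X (rowf s) (colv s) \<noteq> 0" by (intro form_nonzero shear_neq_mat)
  moreover have "\<exists>s. form ?Y (rowf s) (colv s) \<noteq> 0"
    using "3.prems"(4) by (intro form_nonzero) (simp add: x y)
  ultimately have nz': "\<exists>s. \<kappa>' s \<noteq> 0"
    unfolding \<kappa>'_def by (intro polyn_mult_nonzero[OF form_polyn form_polyn])
  have \<kappa>': "\<kappa>' \<in> polyn (2 * (CARD('n) - 1))"
    using form_polyn unfolding \<kappa>'_def polyn_def by (intro alg_gen.mult)
  have "(\<lambda>s. \<kappa> s * \<kappa>' s) \<in> polyn (2 * (CARD('n) - 1))"
    using IH(1) \<kappa>' unfolding polyn_def by (rule alg_gen.mult)
  moreover have "\<exists>s. \<kappa> s * \<kappa>' s \<noteq> 0" by (rule polyn_mult_nonzero[OF IH(1) \<kappa>' IH(3) nz'])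
  moreover have "foldl (\<lambda>B (i, \<epsilon>, c). B ** letter_lead h s i \<epsilon> ** c) B (x # y # ls) =
      smat (\<kappa> s * \<kappa>' s) (B ** shear (h (i, \<not> \<epsilon>)) ** nilp s ** Q)" for B :: "complex ^ 'n ^ 'n" and s
  proof -
    have "foldl (\<lambda>B (i, \<epsilon>, c). B ** letter_lead h s i \<epsilon> ** c) B (x # y # ls) =
        smat (\<kappa> s) (B ** letter_lead h s i \<epsilon> ** c ** shear (h (i', \<not> \<epsilon>')) ** nilp s ** Q)"
      using IH(5)[of s "B ** letter_lead h s i \<epsilon> ** c"] by (simp add: x)
    also have "B ** letter_lead h s i \<epsilon> ** c ** shear (h (i', \<not> \<epsilon>')) ** nilp s ** Q =
        smat (form ?X (rowf s) (colv s)) (B ** shear (h (i, \<not> \<epsilon>)) ** (nilp s ** ?Y ** nilp s) ** Q)"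
      by (simp add: letter_lead_def matrix_mul_assoc)
    also have "\<dots> = smat (\<kappa>' s) (B ** shear (h (i, \<not> \<epsilon>)) ** nilp s ** Q)"
      unfolding outer_mult_outer by (simp add: \<kappa>'_def)
    finally show ?thesis by simp
  qed
  ultimately show ?case using IH(2,4)
    by (intro bexI[of _ "\<lambda>s. \<kappa> s * \<kappa>' s"] exI[of _ Q]) (simp_all add: x \<kappa>'_def del: fun_upd_apply One_nat_def)
qed simp

text \<open>If the product is the scalar z, then c is z times the shear by \<open>h p - h q\<close>,
  and this difference is a quotient of two entries of c. Only finitely many quotients occur, so
  widely spaced values of \<open>h\<close> avoid them.\<close>

lemma exists_separating_shears:
  fixes C :: "(complex ^ 'n ^ 'n) set"
  assumes "finite C" "\<And>c. c \<in> C \<Longrightarrow> invertible c"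
  shows "\<exists>h :: nat \<times> bool \<Rightarrow> complex. inj h \<and>
    (\<forall>p q c z. p \<noteq> q \<longrightarrow> c \<in> C \<longrightarrow> shear (- h p) ** c ** shear (h q) \<noteq> mat z)"
proof -
  \<comment> \<open>Larger than the modulus of every quotient; the summand 1 keeps it positive and
    the comparison strict.\<close>
  define M where "M = 1 + (\<Sum>c\<in>C. cmod (c $ a $ b / c $ a $ a))"
  have M: "M > 0" unfolding M_def by (simp add: add_pos_nonneg sum_nonneg)
  define h :: "nat \<times> bool \<Rightarrow> complex" where "h p = of_real (M * real (to_nat p))" for p
  have far: "cmod (h p - h q) \<ge> M" if "p \<noteq> q" for p q
  proof -
    have "to_nat p \<noteq> to_nat q" using that by simp
    then have "\<bar>real (to_nat p) - real (to_nat q)\<bar> \<ge> 1" by linarith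
    moreover have "cmod (h p - h q) = M * \<bar>real (to_nat p) - real (to_nat q)\<bar>"
      unfolding h_def of_real_diff[symmetric] norm_of_real
      using M by (simp add: right_diff_distrib[symmetric] abs_mult)
    ultimately show ?thesis using M by simp
  qed
  have "inj h"
  proof (rule injI, rule ccontr)
    fix p q assume "h p = h q" "p \<noteq> q"
    then show False using far[of p q] M by simp
  qed
  moreover have "shear (- h p) ** c ** shear (h q) \<noteq> mat z" if "p \<noteq> q" "c \<in> C" for p q c z
  proof
    assume eq: "shear (- h p) ** c ** shear (h q) = mat z"
    have "c = shear (h p) ** (shear (- h p) ** c ** shear (h q)) ** shear (- h q)"
      by (simp add: matrix_mul_assoc[symmetric] shear_mult_assoc shear_mult)
    then have c: "c = smat z (shear (h p - h q))"
      unfolding eq by (simp add: mat_mult_right shear_mult)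
    have "z \<noteq> 0"
    proof
      assume "z = 0"
      then have "c = 0" using c by (simp add: vec_eq_iff)
      obtain c' where "c ** c' = mat 1"
        using assms(2)[OF \<open>c \<in> C\<close>] by (auto simp: invertible_def)
      then have "(c ** c') $ a $ a = 1" by (simp add: mat_def)
      then show False unfolding \<open>c = 0\<close> by (simp add: matrix_matrix_mult_def)
    qed
    then have "c $ a $ b / c $ a $ a = h p - h q" by (simp add: c shear_entries)
    then have "cmod (c $ a $ b / c $ a $ a) \<ge> M" using far[OF \<open>p \<noteq> q\<close>] by simp
    moreover have "cmod (c $ a $ b / c $ a $ a) \<le> (\<Sum>c\<in>C. cmod (c $ a $ b / c $ a $ a))"
      using that(2) assms(1) by (intro member_le_sum) auto
    ultimately show False unfolding M_def by simp
  qed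
  ultimately show ?thesis by blast
qed

lemma letter_subst_polyn:
  "(\<lambda>s. letter_subst h s i \<epsilon> $ j $ k) \<in> polyn (2 * (CARD('n) - 1))"
proof -
  have "(\<lambda>s. s 0) \<in> polyn (2 * (CARD('n) - 1))"
    unfolding polyn_def using nparams_pos by (intro alg_gen.gen) auto
  then have "(\<lambda>s. if \<epsilon> then s 0 else - s 0) \<in> polyn (2 * (CARD('n) - 1))"
    unfolding polyn_def by (cases \<epsilon>) (simp_all add: alg_gen_uminus)
  then have T: "(\<lambda>s. transv (if \<epsilon> then s 0 else - s 0) s $ j $ k) \<in> polyn (2 * (CARD('n) - 1))" for j k
    using colv_polyn rowf_polyn unfolding polyn_def transvection_def
    by (simp add: alg_gen.add alg_gen.mult alg_gen.const)
  then show ?thesis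
    unfolding letter_subst_def polyn_def
    by (intro alg_gen_matrix_mult alg_gen.const)
qed

lemma foldl_letter_subst_polyn:
  assumes "\<And>j k. (\<lambda>s. A s $ j $ k) \<in> polyn (2 * (CARD('n) - 1))"
  shows "(\<lambda>s. foldl (\<lambda>A (i, \<epsilon>, c). A ** letter_subst h s i \<epsilon> ** c) (A s) ls $ j $ k)
    \<in> polyn (2 * (CARD('n) - 1))"
  using assms
proof (induction ls arbitrary: A)
  case (Cons x ls)
  obtain i \<epsilon> c where x: "x = (i, \<epsilon>, c)" by (cases x)
  have "(\<lambda>s. (A s ** letter_subst h s i \<epsilon> ** c) $ j $ k) \<in> polyn (2 * (CARD('n) - 1))" for j k
    using Cons.prems letter_subst_polyn unfolding polyn_def
    by (intro alg_gen_matrix_mult alg_gen.const)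
  from Cons.IH[OF this] show ?case by (simp add: x)
qed simp

text \<open>Nonscalar constants are demanded at critical places only; at the others the separating
  shears provide them.\<close>

lemma word_image_dim_ge:
  fixes w :: "(complex ^ 'n ^ 'n) cword"
  assumes lead: "invertible (lead_const w)" and ne: "letters w \<noteq> []"
    and inv: "\<forall>(i, \<epsilon>, c)\<in>set (letters w). invertible c"
    and crit: "successively (\<lambda>(i, \<epsilon>, c) (i', \<epsilon>', c'). i = i' \<and> \<epsilon>' = (\<not> \<epsilon>) \<longrightarrow> (\<forall>z. c \<noteq> mat z)) (letters w)"
  shows "enat (2 * (CARD('n) - 1)) \<le> zariski_dim (word_image w (SL UNIV) r)"
proof -
  let ?m = "2 * (CARD('n) - 1)" and ?ls = "letters w"
  let ?C = "(\<lambda>(i, \<epsilon>, c). c) ` set ?ls"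
  obtain h :: "nat \<times> bool \<Rightarrow> complex" where "inj h" and
    h: "\<And>p q c z. p \<noteq> q \<Longrightarrow> c \<in> ?C \<Longrightarrow> shear (- h p) ** c ** shear (h q) \<noteq> mat z"
    using exists_separating_shears[of ?C] inv by fastforce
  have "successively (\<lambda>(i, \<epsilon>, c) (i', \<epsilon>', c'). \<forall>z. shear (- h (i, \<epsilon>)) ** c ** shear (h (i', \<not> \<epsilon>')) \<noteq> mat z) ?ls"
  proof (rule successively_mono[OF crit], clarify)
    fix i \<epsilon> c i' \<epsilon>' c' z
    assume x: "(i, \<epsilon>, c) \<in> set ?ls"
      and cr: "i = i' \<and> \<epsilon>' = (\<not> \<epsilon>) \<longrightarrow> (\<forall>z. c \<noteq> mat z)"
      and eq: "shear (- h (i, \<epsilon>)) ** c ** shear (h (i', \<not> \<epsilon>')) = mat z"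
    have "c \<in> ?C" using x by force
    then have same: "(i, \<epsilon>) = (i', \<not> \<epsilon>')" using h[of "(i, \<epsilon>)" "(i', \<not> \<epsilon>')" c z] eq by blast
    have "c = shear (h (i, \<epsilon>)) ** (shear (- h (i, \<epsilon>)) ** c ** shear (h (i, \<epsilon>))) ** shear (- h (i, \<epsilon>))"
      by (simp add: matrix_mul_assoc[symmetric] shear_mult_assoc shear_mult)
    also have "shear (- h (i, \<epsilon>)) ** c ** shear (h (i, \<epsilon>)) = mat z" using eq same by simp
    also have "shear (h (i, \<epsilon>)) ** mat z ** shear (- h (i, \<epsilon>)) = mat z"
      by (simp add: mat_mult_right shear_mult) (simp add: vec_eq_iff mat_def)
    finally show False using cr same by auto
  qed
  from foldl_letter_lead[OF ne \<open>inj h\<close> inv this]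
  obtain \<kappa> Q where \<kappa>: "\<kappa> \<in> polyn ?m" "\<exists>s. \<kappa> s \<noteq> 0" "\<And>s u. \<kappa> (s(0 := u)) = \<kappa> s"
    and Q: "invertible Q"
    and fold: "\<And>(B :: complex ^ 'n ^ 'n) s. foldl (\<lambda>B (i, \<epsilon>, c). B ** letter_lead h s i \<epsilon> ** c) B ?ls =
        smat (\<kappa> s) (B ** shear (h (fst (hd ?ls), \<not> fst (snd (hd ?ls)))) ** nilp s ** Q)"
    by blast
  define P where "P = lead_const w ** shear (h (fst (hd ?ls), \<not> fst (snd (hd ?ls))))"
  have "invertible P" unfolding P_def by (intro invertible_mult lead invertible_shear)
  then obtain P' where P': "P' ** P = mat 1" by (auto simp: invertible_def)
  obtain Q' where Q': "Q ** Q' = mat 1" using Q by (auto simp: invertible_def)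
  \<comment> \<open>All coordinate subspaces of the chain pass through this point, so
    \<open>\<kappa>\<close> is nonzero on each of them.\<close>
  obtain s0 where s0: "\<kappa> s0 \<noteq> 0" using \<kappa>(2) by blast
  define \<psi> where "\<psi> s = word_eval w (\<lambda>i. letter_subst h s i True)" for s
  have \<psi>: "\<psi> s = foldl (\<lambda>A (i, \<epsilon>, c). A ** letter_subst h s i \<epsilon> ** c) (lead_const w) ?ls" for s
  proof -
    have "(if \<epsilon> then letter_subst h s i True else matrix_inv (letter_subst h s i True)) =
        letter_subst h s i \<epsilon>" for i \<epsilon>
      by (simp add: matrix_inv_letter_subst)
    then show ?thesis unfolding \<psi>_def word_eval_def by simp
  qed
  define \<sigma> where "\<sigma> = inv_into (chart_entries a b) \<tau>"
  have \<sigma>: "\<sigma> j \<in> chart_entries a b" "\<tau> (\<sigma> j) = j" if "j < ?m" for j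
    using bij_betw_inv_into[OF \<tau>] bij_betw_inv_into_right[OF \<tau>] that
    unfolding \<sigma>_def by (auto simp: bij_betw_def)
  \<comment> \<open>Linear functions that strip off the invertible factors \<open>P\<close> and
    \<open>Q\<close> and read the \<open>j\<close>-th chart entry.\<close>
  define F where "F j X = (P' ** X ** Q') $ fst (\<sigma> j) $ snd (\<sigma> j)" for j X
  let ?d = "2 * length ?ls"
  have lim: "(\<lambda>n. F j (\<psi> (s(0 := of_nat n))) / of_nat n ^ ?d) \<longlonglongrightarrow>
      \<kappa> s * (if j = 0 then 1 else s j)" if j: "j < ?m" for j s
  proof -
    have "scaled_lim (\<lambda>n. \<psi> (s(0 := of_nat n))) (0 + ?d) (smat (\<kappa> s) (P ** nilp s ** Q))"
      using scaled_lim_foldl[OF scaled_lim_const[of "lead_const w"], where h = h and s = s and ls = ?ls]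
      unfolding \<psi> P_def by (simp only: fold)
    then have "scaled_lim (\<lambda>n. P' ** \<psi> (s(0 := of_nat n)) ** Q') (0 + (0 + ?d) + 0)
        (P' ** smat (\<kappa> s) (P ** nilp s ** Q) ** Q')"
      by (intro scaled_lim_mult scaled_lim_const)
    moreover have "P' ** smat (\<kappa> s) (P ** nilp s ** Q) ** Q' = smat (\<kappa> s) ((P' ** P) ** nilp s ** (Q ** Q'))"
      by (simp add: matrix_mul_assoc)
    ultimately have "scaled_lim (\<lambda>n. P' ** \<psi> (s(0 := of_nat n)) ** Q') ?d (smat (\<kappa> s) (nilp s))"
      by (simp add: P' Q')
    then have "(\<lambda>n. F j (\<psi> (s(0 := of_nat n))) / of_nat n ^ ?d) \<longlonglongrightarrow>
        \<kappa> s * nilp s $ fst (\<sigma> j) $ snd (\<sigma> j)"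
      unfolding scaled_lim_def F_def by simp
    then show ?thesis unfolding nilp_entries[OF \<sigma>(1)[OF j]] \<sigma>(2)[OF j] .
  qed
  show ?thesis
  proof (rule zariski_dim_ge)
    show "(\<lambda>s. \<psi> s $ i $ j) \<in> polyn ?m" for i j
      unfolding \<psi> by (rule foldl_letter_subst_polyn) (simp add: polyn_def alg_gen.const)
    show "\<psi> s \<in> word_image w (SL UNIV) r" for s
      unfolding word_image_def \<psi>_def
      by (rule imageI) (simp add: SL_def det_letter_subst)
    show "F j \<in> poly_functions" for j
      unfolding F_def poly_functions_eq_alg_gen
      by (intro alg_gen_matrix_mult alg_gen.const entry_in_alg_gen)
    show "alg_indep i (\<lambda>j s. F j (\<psi> (freeze s0 i s))) UNIV" if "i \<le> ?m" for i
    \<comment> \<open>For positive \<open>i\<close> parameter 0 stays free and can tend to infinity;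
      for \<open>i = 0\<close> it is frozen, but there the claim is trivial.\<close>
    proof (cases "i = 0")
      case False
      show ?thesis
      proof (rule alg_indep_leading)
        show "0 < i" using False by simp
        show "0 < ?d" using ne by simp
        show "(\<lambda>s. \<kappa> (freeze s0 i s)) \<in> polyn i" by (rule polyn_freeze[OF \<kappa>(1)])
        have "freeze s0 i s0 = s0" by (auto simp: freeze_def)
        then show "\<kappa> (freeze s0 i s0) \<noteq> 0" using s0 by simp
        fix s j assume j: "j < i"
        have upd: "freeze s0 i (s(0 := t)) = (freeze s0 i s)(0 := t)" for t
          using False by (auto simp: freeze_def)
        have j': "freeze s0 i s j = s j" using j by (simp add: freeze_def)
        have "j < ?m" using j that by simp
        from lim[OF this, of "freeze s0 i s"] show "(\<lambda>n. F j (\<psi> (freeze s0 i (s(0 := of_nat n)))) / of_nat n ^ ?d)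
            \<longlonglongrightarrow> \<kappa> (freeze s0 i s) * (if j = 0 then 1 else s j)"
          unfolding upd j' .
      qed
    qed (simp add: alg_indep_0)
  qed
qed

end

subsection \<open>The conjugacy class of a transvection\<close>

lemma adjugate_mult:
  fixes A :: "'a::field ^ 'n ^ 'n"
  assumes "det A \<noteq> 0"
  shows "(adjugate A ** A) $ k $ l = (if k = l then det A else 0)"
proof -
  let ?B = "\<chi> k l. adjugate A $ k $ l / det A"
  have "A *v (\<chi> k. det (\<chi> i j. if j = k then axis l 1 $ i else A $ i $ j) / det A) = axis l 1" for l
    using cramer[OF assms, of _ "axis l 1"] by blast
  then have "(\<Sum>k\<in>UNIV. A $ m $ k * (adjugate A $ k $ l / det A)) = axis l 1 $ m" for m l
    unfolding adjugate_def matrix_vector_mult_def vec_eq_iff by simp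
  then have "A ** ?B = mat 1"
    by (simp add: vec_eq_iff matrix_matrix_mult_def mat_def axis_def)
  then have "?B ** A = mat 1" using matrix_left_right_inverse by blast
  then have "(?B ** A) $ k $ l = (if k = l then 1 else 0)" by (simp add: mat_def)
  then have "(\<Sum>m\<in>UNIV. adjugate A $ k $ m * A $ m $ l) / det A = (if k = l then 1 else 0)"
    by (simp add: matrix_matrix_mult_def sum_divide_distrib)
  then show ?thesis using assms by (auto simp: matrix_matrix_mult_def split: if_splits)
qed

context nilpotent_chart
begin

lemma conj_shear_1: "X ** shear 1 ** Y = X ** Y + outer (column a X) (row b Y)"
proof -
  have "X ** outer (axis a 1) (axis b 1) = outer (column a X) (axis b 1)"
    unfolding vec_eq_iff matrix_matrix_mult_def column_def
    by (simp add: axis_def mult.assoc[symmetric] sum_distrib_right[symmetric]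
        if_distrib[of "\<lambda>x. _ * x"] cong: if_cong)
  moreover have "outer (column a X) (axis b 1) ** Y = outer (column a X) (row b Y)"
    unfolding vec_eq_iff matrix_matrix_mult_def row_def
    by (simp add: axis_def mult.assoc sum_distrib_left[symmetric]
        if_distrib[of "\<lambda>x. x * _"] cong: if_cong)
  ultimately have "X ** outer (axis a 1) (axis b 1) ** Y = outer (column a X) (row b Y)" by simp
  then show ?thesis
    unfolding shear_def transvection_def by (simp add: matrix_add_ldistrib matrix_add_rdistrib)
qed

definition shear_word :: "(complex ^ 'n ^ 'n) cword" where
  "shear_word = CWord (mat 1) [(0, True, shear 1), (0, False, mat 1)]"

text \<open>The chart covers the transvections with nonvanishing coordinates \<open>v\<^sub>a\<close> and \<open>f\<^sub>b\<close>; the others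
  are dealt with by the irreducibility of the space of all matrices.\<close>

lemma shear_word_dim_le:
  "zariski_dim (word_image shear_word (SL UNIV) 1) \<le> enat (2 * (CARD('n) - 1))"
proof (rule zariski_dim_le)
  show "(\<lambda>s. (mat 1 + smat (s 0) (nilp s)) $ i $ j) \<in> polyn (2 * (CARD('n) - 1))" for i j
  proof -
    have "(\<lambda>s. s 0) \<in> polyn (2 * (CARD('n) - 1))"
      unfolding polyn_def using nparams_pos by (intro alg_gen.gen) auto
    then show ?thesis
      using colv_polyn rowf_polyn unfolding polyn_def
      by (simp add: alg_gen.add alg_gen.mult alg_gen.const)
  qed
  fix p :: "complex ^ 'n ^ 'n \<Rightarrow> complex"
  assume p: "p \<in> poly_functions" and zero: "zeros_on p (range (\<lambda>s. mat 1 + smat (s 0) (nilp s)))"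
  \<comment> \<open>For determinant 1 this is \<open>p\<close> at the conjugate of
    \<open>shear 1\<close> by X; the formula itself is polynomial on all matrices.\<close>
  let ?q = "\<lambda>X. p (mat 1 + outer (column a X) (row b (adjugate X)))"
  \<comment> \<open>Where this is nonzero the chart applies: the first two factors are the
    coordinates of v at \<open>a\<close> and of f at \<open>b\<close>, and a nonzero determinant
    yields f v = 0 through the off-diagonal entries of adjugate times X.\<close>
  let ?c = "\<lambda>X :: complex ^ 'n ^ 'n. X $ a $ a * (adjugate X $ b $ b * det X)"
  have adj: "(\<lambda>X :: complex ^ 'n ^ 'n. adjugate X $ i $ j) \<in> alg_gen matrix_entries" for i j
    by (intro alg_gen_adjugate entry_in_alg_gen)
  have "?q \<in> poly_functions"
    unfolding poly_functions_eq_alg_gen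
  proof (rule poly_functions_compose[OF p])
    show "(\<lambda>X. (mat 1 + outer (column a X) (row b (adjugate X))) $ i $ j) \<in> alg_gen matrix_entries" for i j
      unfolding vector_add_component outer_nth column_def row_def vec_lambda_beta
      by (intro alg_gen.add alg_gen.mult alg_gen.const adj entry_in_alg_gen)
  qed
  moreover have "?c \<in> poly_functions"
    unfolding poly_functions_eq_alg_gen
    by (intro alg_gen.mult adj entry_in_alg_gen alg_gen_det)
  moreover have "?q X * ?c X = 0" for X
  proof (cases "?c X = 0")
    case False
    let ?v = "column a X" and ?f = "row b (adjugate X)"
    have "(\<Sum>i\<in>UNIV. ?f $ i * ?v $ i) = (adjugate X ** X) $ b $ a"
      by (simp add: matrix_matrix_mult_def row_def column_def)
    then have "form (mat 1) ?f ?v = 0"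
      unfolding form_mat_1 using adjugate_mult[of X b a] False ab by auto
    moreover have "?v $ a \<noteq> 0" "?f $ b \<noteq> 0" using False by (auto simp: column_def row_def)
    ultimately obtain s where "outer ?v ?f = smat (s 0) (nilp s)" by (rule chart_point_eq)
    then show ?thesis using zero by (simp add: zeros_on_def)
  qed simp
  ultimately have "(\<forall>X\<in>UNIV. ?q X = 0) \<or> (\<forall>X\<in>UNIV. ?c X = 0)"
    by (intro integral_onD[OF integral_on_poly_functions])
  moreover have "adjugate (mat 1 :: complex ^ 'n ^ 'n) = mat 1"
    using matrix_inv_eq_adjugate[of "mat 1 :: complex ^ 'n ^ 'n"]
      matrix_inv_unique[of "mat 1 :: complex ^ 'n ^ 'n" "mat 1"] by simp
  then have "?c (mat 1) \<noteq> 0" by simp (simp add: mat_def)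
  ultimately have q: "?q X = 0" for X by blast
  show "zeros_on p (word_image shear_word (SL UNIV) 1)"
    unfolding zeros_on_def word_image_def
  proof (intro ballI, elim imageE)
    fix A and g :: "nat \<Rightarrow> complex ^ 'n ^ 'n"
    assume g: "g \<in> {g. \<forall>i<1. g i \<in> SL UNIV}" and A: "A = word_eval shear_word g"
    then have "det (g 0) = 1" by (simp add: SL_def)
    then have inv: "matrix_inv (g 0) = adjugate (g 0)" "g 0 ** matrix_inv (g 0) = mat 1"
      by (rule matrix_inv_eq_adjugate) (simp add: matrix_inv_right invertible_det_nz \<open>det (g 0) = 1\<close>)
    have "A = g 0 ** shear 1 ** matrix_inv (g 0)"
      by (simp add: A word_eval_def shear_word_def)
    also have "\<dots> = mat 1 + outer (column a (g 0)) (row b (adjugate (g 0)))"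
      unfolding conj_shear_1 using inv by simp
    finally show "p A = 0" using q[of "g 0"] by simp
  qed
qed

end

subsection \<open>Removing scalar critical constants\<close>

lemma not_successively_split:
  "\<not> successively P xs \<Longrightarrow> \<exists>ys x y zs. xs = ys @ x # y # zs \<and> \<not> P x y"
proof (induction xs rule: induct_list012)
  case (3 x y zs)
  then show ?case by (cases "P x y") (auto, metis Cons_eq_appendI, blast)
qed auto

definition word_step ::
    "(nat \<Rightarrow> 'a::field ^ 'n ^ 'n) \<Rightarrow> 'a ^ 'n ^ 'n \<Rightarrow> nat \<times> bool \<times> ('a ^ 'n ^ 'n) \<Rightarrow> 'a ^ 'n ^ 'n" where
  "word_step g = (\<lambda>A (i, \<epsilon>, c). A ** (if \<epsilon> then g i else matrix_inv (g i)) ** c)"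

lemma word_eval_word_step: "word_eval w g = foldl (word_step g) (lead_const w) (letters w)"
  by (simp add: word_eval_def word_step_def)

lemma word_step_cancel:
  fixes A :: "complex ^ 'n ^ 'n"
  assumes "invertible (g i)"
  shows "word_step g (word_step g A (i, \<epsilon>, mat z)) (i, \<not> \<epsilon>, c) = A ** (mat z ** c)"
proof -
  have "A ** X ** mat z ** Y ** c = A ** (mat z ** c)" if "X ** Y = mat 1" for X Y :: "complex ^ 'n ^ 'n"
  proof -
    have "A ** X ** mat z ** Y ** c = smat z (A ** (X ** Y) ** c)"
      by (simp add: mat_mult_right matrix_mul_assoc)
    then show ?thesis using that by (simp add: mat_mult_left)
  qed
  then show ?thesis
    using matrix_inv_left[OF assms] matrix_inv_right[OF assms]
    unfolding word_step_def by (cases \<epsilon>) simp_all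
qed

definition noncritical :: "nat \<times> bool \<times> (complex ^ 'n ^ 'n) \<Rightarrow> nat \<times> bool \<times> (complex ^ 'n ^ 'n) \<Rightarrow> bool" where
  "noncritical = (\<lambda>(i, \<epsilon>, c) (i', \<epsilon>', c'). i = i' \<and> \<epsilon>' = (\<not> \<epsilon>) \<longrightarrow> (\<forall>z. c \<noteq> mat z))"

text \<open>A scalar is central, so a scalar critical constant lets the letters on both sides
  cancel; it is absorbed, with the constant after them, into the preceding constant. This may create
  a new scalar critical constant, hence the induction on the length.\<close>

lemma exists_noncritical_word:
  fixes w :: "(complex ^ 'n ^ 'n) cword"
  assumes "invertible (lead_const w)" "\<forall>(i, \<epsilon>, c)\<in>set (letters w). i < r \<and> invertible c"
  shows "\<exists>w'. invertible (lead_const w') \<and> (\<forall>(i, \<epsilon>, c)\<in>set (letters w'). i < r \<and> invertible c) \<and>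
    successively noncritical (letters w') \<and>
    (\<forall>g. (\<forall>i<r. invertible (g i)) \<longrightarrow> word_eval w' g = word_eval w g)"
  using assms
proof (induction w rule: measure_induct_rule[of "\<lambda>w. length (letters w)"])
  case (less w)
  show ?case
  proof (cases "successively noncritical (letters w)")
    case True
    then show ?thesis using less.prems by blast
  next
    case False
    then obtain ys x y zs where "letters w = ys @ x # y # zs" "\<not> noncritical x y"
      using not_successively_split by blast
    then obtain i \<epsilon> z c where w: "letters w = ys @ (i, \<epsilon>, mat z) # (i, \<not> \<epsilon>, c) # zs"
      unfolding noncritical_def by (cases x; cases y) auto
    have zc: "invertible (mat z ** c)" and "i < r"
      using less.prems(2) by (auto simp: w intro: invertible_mult)
    have "\<exists>w1. length (letters w1) < length (letters w) \<and> invertible (lead_const w1) \<and>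
        (\<forall>(i, \<epsilon>, c)\<in>set (letters w1). i < r \<and> invertible c) \<and>
        (\<forall>g. (\<forall>i<r. invertible (g i)) \<longrightarrow> word_eval w1 g = word_eval w g)"
    \<comment> \<open>The preceding constant is the leading one if no letter comes before the pair,
      and otherwise belongs to the last letter before it.\<close>
    proof (cases ys rule: rev_cases)
      case Nil
      show ?thesis
      proof (intro exI[of _ "CWord (lead_const w ** (mat z ** c)) zs"] conjI allI impI)
        show "invertible (lead_const (CWord (lead_const w ** (mat z ** c)) zs))"
          using less.prems(1) zc by (simp add: invertible_mult)
        fix g :: "nat \<Rightarrow> complex ^ 'n ^ 'n" assume "\<forall>i<r. invertible (g i)"
        then have "invertible (g i)" using \<open>i < r\<close> by simp
        then show "word_eval (CWord (lead_const w ** (mat z ** c)) zs) g = word_eval w g"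
          by (simp add: word_eval_word_step w Nil word_step_cancel)
      qed (use less.prems(2) in \<open>auto simp: w\<close>)
    next
      case (snoc ys' x)
      obtain j \<delta> d where x: "x = (j, \<delta>, d)" by (cases x)
      let ?w = "CWord (lead_const w) (ys' @ (j, \<delta>, d ** (mat z ** c)) # zs)"
      show ?thesis
      proof (intro exI[of _ ?w] conjI allI impI)
        have "invertible d" using less.prems(2) by (simp add: w snoc x)
        then have "invertible (d ** (mat z ** c))" using zc by (rule invertible_mult)
        then show "\<forall>(i, \<epsilon>, c)\<in>set (letters ?w). i < r \<and> invertible c"
          using less.prems(2) by (auto simp: w snoc x)
        fix g :: "nat \<Rightarrow> complex ^ 'n ^ 'n" assume "\<forall>i<r. invertible (g i)"
        then have "invertible (g i)" using \<open>i < r\<close> by simp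
        moreover have "word_step g A (j, \<delta>, d ** (mat z ** c)) = word_step g A (j, \<delta>, d) ** (mat z ** c)" for A
          by (simp add: word_step_def matrix_mul_assoc)
        ultimately show "word_eval ?w g = word_eval w g"
          by (simp add: word_eval_word_step w snoc x word_step_cancel)
      qed (use less.prems(1) in \<open>auto simp: w snoc\<close>)
    qed
    then obtain w1 where w1: "length (letters w1) < length (letters w)" "invertible (lead_const w1)"
      "\<forall>(i, \<epsilon>, c)\<in>set (letters w1). i < r \<and> invertible c"
      "\<forall>g. (\<forall>i<r. invertible (g i)) \<longrightarrow> word_eval w1 g = word_eval w g" by blast
    from less.IH[OF w1(1,2,3)] w1(4) show ?thesis by metis
  qed
qed

subsection \<open>The minimal dimension\<close>

lemma zariski_dim_singleton: "T \<subseteq> {x} \<Longrightarrow> zariski_dim T = 0"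
  using zariski_dim_le[of "\<lambda>_. x" 0 T]
  by (auto simp: polyn_def alg_gen.const zeros_on_def zero_enat_def[symmetric])

lemma word_image_cong:
  assumes "\<And>g. \<forall>i<r. invertible (g i) \<Longrightarrow> word_eval w' g = word_eval w g"
  shows "word_image w' (SL K) r = word_image w (SL K) r"
  unfolding word_image_def by (intro image_cong refl assms) (auto intro: invertible_SL)

text \<open>A reduced word may still have central critical constants, so the lower bound is applied
  after removing them. Nonconstancy of the word map guarantees that some letter survives; the
  conjugacy class of a transvection attains the bound.\<close>

lemma sl_min_dim_eq:
  assumes K: "K \<in> {\<real>, UNIV}"
  shows "sl_min_dim TYPE('n::finite) K = enat (2 * (CARD('n) - 1))"
proof -
  have dimK: "zariski_dim (word_image u (SL K) s) = zariski_dim (word_image u (SL UNIV) s)"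
    for u :: "(complex ^ 'n ^ 'n) cword" and s
    using K zariski_dim_word_image_real by auto
  show ?thesis
  proof (cases "CARD('n) \<ge> 2")
    case True
    then obtain a b :: 'n and \<tau> where "nilpotent_chart a b \<tau>" by (rule exists_nilpotent_chart)
    then interpret nilpotent_chart a b \<tau> .
    have pos: "zariski_dim T \<noteq> 0" if "enat (2 * (CARD('n) - 1)) \<le> zariski_dim T"
      for T :: "(complex ^ 'n ^ 'n) set"
      using that nparams_pos by (auto simp: zero_enat_def)
    show ?thesis
      unfolding sl_min_dim_def
    proof (rule antisym)
      have dim: "enat (2 * (CARD('n) - 1)) \<le> zariski_dim (word_image shear_word (SL UNIV) 1)"
        by (rule word_image_dim_ge)
          (use shear_neq_mat[of 1] in \<open>auto simp: shear_word_def det_shear invertible_det_nz\<close>)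
      \<comment> \<open>A point has dimension 0, whereas the lower bound for this image is
        positive.\<close>
      have "\<not> is_singleton (word_image shear_word (SL K) 1)"
      proof
        assume "is_singleton (word_image shear_word (SL K) 1)"
        then have "zariski_dim (word_image shear_word (SL K) 1) = 0"
          unfolding is_singleton_def by (metis zariski_dim_singleton order_refl)
        then show False using pos[OF dim] unfolding dimK by simp
      qed
      moreover have "shear_word \<in> free_product_words (SL UNIV) 1"
        using shear_neq_mat[of 1 1]
        by (auto simp: free_product_words_def shear_word_def critical_constants_def SL_def det_shear
            less_Suc_eq nth_Cons')
      moreover have "word_length shear_word \<ge> 1" by (simp add: word_length_def shear_word_def)
      ultimately have "Inf {zariski_dim (word_image u (SL K) s) | (u :: (complex ^ 'n ^ 'n) cword) s.
            u \<in> free_product_words (SL UNIV) s \<and> word_length u \<ge> 1 \<and>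
            (CARD('n) \<ge> 2 \<longrightarrow> \<not> is_singleton (word_image u (SL K) s))}
          \<le> zariski_dim (word_image shear_word (SL K) 1)"
        by (intro Inf_lower) blast
      also have "\<dots> \<le> enat (2 * (CARD('n) - 1))" unfolding dimK by (rule shear_word_dim_le)
      finally show "Inf {zariski_dim (word_image u (SL K) s) | (u :: (complex ^ 'n ^ 'n) cword) s.
            u \<in> free_product_words (SL UNIV) s \<and> word_length u \<ge> 1 \<and>
            (CARD('n) \<ge> 2 \<longrightarrow> \<not> is_singleton (word_image u (SL K) s))} \<le> enat (2 * (CARD('n) - 1))" .
    next
      show "enat (2 * (CARD('n) - 1)) \<le> Inf {zariski_dim (word_image u (SL K) s) | (u :: (complex ^ 'n ^ 'n) cword) s.
            u \<in> free_product_words (SL UNIV) s \<and> word_length u \<ge> 1 \<and>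
            (CARD('n) \<ge> 2 \<longrightarrow> \<not> is_singleton (word_image u (SL K) s))}"
      proof (rule Inf_greatest, clarify)
        fix u :: "(complex ^ 'n ^ 'n) cword" and s
        assume u: "u \<in> free_product_words (SL UNIV) s"
          and "CARD('n) \<ge> 2 \<longrightarrow> \<not> is_singleton (word_image u (SL K) s)"
        then have ns: "\<not> is_singleton (word_image u (SL K) s)" using True by simp
        have "invertible (lead_const u)" "\<forall>(i, \<epsilon>, c)\<in>set (letters u). i < s \<and> invertible c"
          using u unfolding free_product_words_def by (auto intro: invertible_SL)
        from exists_noncritical_word[OF this] obtain u' where
          u': "invertible (lead_const u')" "\<forall>(i, \<epsilon>, c)\<in>set (letters u'). i < s \<and> invertible c"
            "successively noncritical (letters u')"
            "\<And>g. \<forall>i<s. invertible (g i) \<Longrightarrow> word_eval u' g = word_eval u g"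
          by blast
        have img: "word_image u' (SL K') s = word_image u (SL K') s" for K'
          by (rule word_image_cong) (rule u'(4))
        \<comment> \<open>If all letters cancelled, the image would be a single point.\<close>
        have "letters u' \<noteq> []"
        proof
          assume "letters u' = []"
          then have "word_eval u' g = lead_const u'" for g by (simp add: word_eval_def)
          moreover have "mat 1 \<in> (SL K :: (complex ^ 'n ^ 'n) set)"
            using K by (auto simp: SL_def) (simp add: mat_def)
          then have "(\<lambda>_. mat 1) \<in> {g. \<forall>i<s. g i \<in> (SL K :: (complex ^ 'n ^ 'n) set)}" by simp
          ultimately have "word_image u' (SL K) s = {lead_const u'}"
            unfolding word_image_def by auto
          with ns show False by (simp add: img is_singleton_def)
        qed
        moreover have "\<forall>(i, \<epsilon>, c)\<in>set (letters u'). invertible c" using u'(2) by auto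
        ultimately have "enat (2 * (CARD('n) - 1)) \<le> zariski_dim (word_image u' (SL UNIV) s)"
          using u'(1,3) unfolding noncritical_def by (intro word_image_dim_ge)
        then show "enat (2 * (CARD('n) - 1)) \<le> zariski_dim (word_image u (SL K) s)"
          unfolding dimK img .
      qed
    qed
  next
    case False
    moreover have "CARD('n) > 0" by simp
    ultimately have "CARD('n) = 1" by linarith
    then obtain a :: 'n where a: "UNIV = {a}" by (auto simp: card_1_singleton_iff)
    have SL1: "A = mat 1" if "A \<in> SL UNIV" for A :: "complex ^ 'n ^ 'n"
    proof -
      have all: "i = a" for i :: 'n using a by blast
      have "det A = (\<Prod>i\<in>UNIV. A $ i $ i)" by (rule det_diagonal) (metis all)
      then have "A $ a $ a = 1" using that by (simp add: SL_def a)
      moreover have "A $ i $ j = A $ a $ a" "(mat 1 :: complex ^ 'n ^ 'n) $ i $ j = 1" for i j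
        using all[of i] all[of j] by (simp_all add: mat_def)
      ultimately show ?thesis by (simp add: vec_eq_iff)
    qed
    \<comment> \<open>For n = 1 the group is trivial, and any word with a letter has a one-point
      image of dimension 0.\<close>
    let ?u = "CWord (mat 1) [(0, True, mat 1)] :: (complex ^ 'n ^ 'n) cword"
    have "word_image ?u (SL UNIV) 1 \<subseteq> {mat 1}"
      by (auto simp: word_image_def word_eval_def dest: SL1)
    then have "zariski_dim (word_image ?u (SL K) 1) = 0"
      unfolding dimK by (rule zariski_dim_singleton)
    moreover have "?u \<in> free_product_words (SL UNIV) 1" "word_length ?u \<ge> 1"
      by (auto simp: free_product_words_def SL_def critical_constants_def word_length_def)
    ultimately have "sl_min_dim TYPE('n) K \<le> 0"
      unfolding sl_min_dim_def using False by (intro Inf_lower) force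
    then show ?thesis using \<open>CARD('n) = 1\<close> by (simp flip: zero_enat_def)
  qed
qed

text \<open>A scalar is fixed under conjugation and preserves the line of the first basis vector, on
  which the last dual vector vanishes as soon as n is at least 2. For n = 1 the two indices coincide
  and no invertible scalar is small.\<close>

lemma scalar_tomanov_small:
  fixes e :: "nat \<Rightarrow> complex ^ 'n"
  assumes e: "ordered_basis e" and n: "CARD('n) \<ge> 2" and "(mat z :: complex ^ 'n ^ 'n) \<in> GL"
  shows "mat z \<in> tomanov_small e"
  unfolding tomanov_small_def
proof (intro CollectI conjI ballI assms(3))
  fix g :: "complex ^ 'n ^ 'n" assume "g \<in> SL UNIV"
  then have "matrix_inv g ** g = mat 1" by (intro matrix_inv_left invertible_SL)
  then have "matrix_inv g ** mat z ** g = mat z"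
    by (simp add: mat_mult_right) (simp add: vec_eq_iff mat_def)
  moreover have "e 1 v* mat z = z *s e 1"
    by (simp add: vec_eq_iff vector_matrix_mult_def mat_def if_distrib[of "\<lambda>x. _ * x"]
        if_distrib[of "\<lambda>x. x * _"] mult.commute cong: if_cong)
  moreover have "dual_basis e CARD('n) (z *s e 1) = 0"
  proof -
    let ?B = "e ` {1..CARD('n)}"
    have ind: "vec.independent ?B" and span: "vec.span ?B = UNIV" and inj: "inj_on e {1..CARD('n)}"
      using e by (auto simp: ordered_basis_def)
    have "e 1 \<in> ?B" using n by auto
    moreover have "e CARD('n) \<noteq> e 1" using inj_on_eq_iff[OF inj, of "CARD('n)" 1] n by auto
    ultimately show ?thesis
      unfolding dual_basis_def using ind span
      by (simp add: vec.representation_scale vec.representation_basis)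
  qed
  ultimately show "dual_basis e CARD('n) (e 1 v* (matrix_inv g ** mat z ** g)) = 0" by simp
qed

theorem corollary21:
  fixes w :: "(complex ^ 'n ^ 'n) cword"
    and e :: "nat \<Rightarrow> complex ^ 'n"
    and K :: "complex set"
    and r :: nat
  assumes "K \<in> {\<real>, UNIV}"
    and "ordered_basis e"
    and "w \<in> free_product_words GL r"
    and "word_length w \<ge> 2"
    and "tomanov_small e \<inter> critical_constants w = {}"
  shows "zariski_dim (word_image w (SL \<real>) r) = zariski_dim (word_image w (SL UNIV) r) \<and>
         zariski_dim (word_image w (SL UNIV) r) \<ge> sl_min_dim TYPE('n) K \<and>
         sl_min_dim TYPE('n) K = enat (2 * (CARD('n) - 1))"
proof (intro conjI)
  show "zariski_dim (word_image w (SL \<real>) r) = zariski_dim (word_image w (SL UNIV) r)"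
    by (rule zariski_dim_word_image_real)
  show min: "sl_min_dim TYPE('n) K = enat (2 * (CARD('n) - 1))"
    by (rule sl_min_dim_eq[OF assms(1)])
  show "sl_min_dim TYPE('n) K \<le> zariski_dim (word_image w (SL UNIV) r)"
  proof (cases "CARD('n) \<ge> 2")
    case True
    then obtain a b :: 'n and \<tau> where "nilpotent_chart a b \<tau>" by (rule exists_nilpotent_chart)
    then interpret nilpotent_chart a b \<tau> .
    have inv: "invertible (lead_const w)" "\<forall>(i, \<epsilon>, c)\<in>set (letters w). invertible c"
      using assms(3) by (auto simp: free_product_words_def GL_def)
    have "successively noncritical (letters w)"
      unfolding successively_conv_nth
    proof (intro allI impI)
      fix j assume j: "Suc j < length (letters w)"
      obtain i \<epsilon> c where x: "letters w ! j = (i, \<epsilon>, c)" by (cases "letters w ! j")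
      obtain i' \<epsilon>' c' where y: "letters w ! Suc j = (i', \<epsilon>', c')" by (cases "letters w ! Suc j")
      have "letters w ! j \<in> set (letters w)" using j by simp
      then have "invertible c" using inv(2) unfolding x by fast
      then have GL: "c \<in> GL" by (simp add: GL_def)
      \<comment> \<open>Reducedness excludes only the scalar 1 as a critical constant; the
        assumption on small constants excludes the other scalars.\<close>
      have "c \<noteq> mat z" if "i = i'" "\<epsilon>' = (\<not> \<epsilon>)" for z
      proof
        assume "c = mat z"
        then have "c \<in> tomanov_small e"
          using scalar_tomanov_small[OF assms(2) True] GL by simp
        moreover have "c \<in> critical_constants w"
          unfolding critical_constants_def using j x y that by blast
        ultimately show False using assms(5) by blast
      qed
      then show "noncritical (letters w ! j) (letters w ! Suc j)"
        unfolding x y noncritical_def by simp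
    qed
    moreover have "letters w \<noteq> []" using assms(4) by (auto simp: word_length_def)
    ultimately show ?thesis
      unfolding min noncritical_def using inv by (intro word_image_dim_ge)
  next
    case False
    then have "CARD('n) - 1 = 0" by linarith
    then show ?thesis unfolding min by (simp add: zero_enat_def[symmetric])
  qed
qed

end
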